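(* Let $X$ and $Y$ be infinite dimensional complex Banach spaces, and let $S\in L(X)$ and $T\in L(Y)$ be $(H)$-operators. If $S$ and $T$ both satisfy property $(az)$, then $S\oplus T\in L(X\oplus Y)$ satisfies property $(az)$. If $S$ and $T$ both satisfy property $(z)$, then $S\oplus T$ satisfies property $(z)$.
   Context: $L(X)$ is the algebra of bounded linear operators on $X$. For a bounded operator $T$ on $X$: $N(T)$ is the kernel, $R(T)$ the range, $\alpha(T)=\dim N(T)$, $\beta(T)=\operatorname{codim} R(T)$; $\sigma(T)$ is the spectrum and $\sigma_a(T)$ the approximate point spectrum; $\mathrm{iso}\,A$ is the set of isolated points of $A\subset\mathbb{C}$. The quasinilpotent part of $T$ is $H_0(T)=\{x\in X:\lim_{n\to\infty}\|T^n x\|^{1/n}=0\}$. $T$ is an $(H)$-operator (belongs to the class $(H)$) if for every $\lambda\in\mathbb{C}$ there exists $p=p(\lambda)\in\mathbb{N}$ with $H_0(T-\lambda I)=N((T-\lambda I)^p)$. $T$ is upper semi-Fredholm if $R(T)$ is closed and $\alpha(T)<\infty$, with index $\operatorname{ind}T=\alpha(T)-\beta(T)$; it is upper semi-Weyl if moreover $\operatorname{ind}T\le 0$. $\sigma_{uw}(T)$ is the set of $\lambda\in\mathbb{C}$ such that $T-\lambda I$ is not upper semi-Weyl. The ascent is $a(T)=\inf\{n\ge 0: N(T^n)=N(T^{n+1})\}$ ($\inf\emptyset=\infty$). A point $\lambda\in\sigma_a(T)$ is a left pole of $T$ if $p=a(T-\lambda I)<\infty$ and $R((T-\lambda I)^{p+1})$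 is closed; it is of finite rank if moreover $\alpha(T-\lambda I)<\infty$. $p_{00}^a(T)$ is the set of left poles of $T$ of finite rank. $\sigma_p^0(T)$ is the set of eigenvalues of finite multiplicity ($0<\alpha(T-\lambda I)<\infty$), and $\pi_{00}^a(T)=\mathrm{iso}\,\sigma_a(T)\cap\sigma_p^0(T)$. $T$ satisfies property $(z)$ if $\sigma(T)\setminus\sigma_{uw}(T)=\pi_{00}^a(T)$, and property $(az)$ if $\sigma(T)\setminus\sigma_{uw}(T)=p_{00}^a(T)$. *)

theory Defs
  imports "HOL-Analysis.Analysis"
begin

text \<open>
  A complex Banach space is a Banach space over the reals whose real scalar multiplication is the
  restriction of a complex one, the norm being homogeneous for complex scalars.
\<close>

class complex_banach = banach +
  fixes scaleC :: "complex \<Rightarrow> 'a \<Rightarrow> 'a"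
  assumes scaleC_add_right: "scaleC a (x + y) = scaleC a x + scaleC a y"
    and scaleC_add_left: "scaleC (a + b) x = scaleC a x + scaleC b x"
    and scaleC_scaleC: "scaleC a (scaleC b x) = scaleC (a * b) x"
    and scaleC_of_real: "scaleC (complex_of_real r) x = scaleR r x"
    and norm_scaleC: "norm (scaleC a x) = cmod a * norm x"

interpretation complex_vector: vector_space "scaleC :: complex \<Rightarrow> 'a \<Rightarrow> 'a::complex_banach"
proof
  fix x :: 'a
  show "scaleC 1 x = x"
    using scaleC_of_real[of 1 x] by simp
qed (simp_all add: scaleC_add_right scaleC_add_left scaleC_scaleC)

text \<open>
  The direct sum of two spaces is the product type, whose library norm
  \<open>norm (x, y) = sqrt ((norm x)\<^sup>2 + (norm y)\<^sup>2)\<close> is one of the usual equivalent norms.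
\<close>

instantiation prod :: (complex_banach, complex_banach) complex_banach
begin

definition scaleC_prod_def: "scaleC c z = (scaleC c (fst z), scaleC c (snd z))"

instance
proof
  fix a b :: complex and r :: real and x y :: "'a \<times> 'b"
  show "scaleC a (x + y) = scaleC a x + scaleC a y"
    by (simp add: scaleC_prod_def scaleC_add_right)
  show "scaleC (a + b) x = scaleC a x + scaleC b x"
    by (simp add: scaleC_prod_def scaleC_add_left)
  show "scaleC a (scaleC b x) = scaleC (a * b) x"
    by (simp add: scaleC_prod_def scaleC_scaleC)
  show "scaleC (complex_of_real r) x = scaleR r x"
    by (simp add: scaleC_prod_def scaleC_of_real scaleR_prod_def)
  show "norm (scaleC a x) = cmod a * norm x"
    by (simp add: scaleC_prod_def norm_prod_def norm_scaleC power_mult_distrib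
        distrib_left [symmetric] real_sqrt_mult)
qed

end

text \<open>The library's \<open>dim\<close> is a natural number, with value \<open>0\<close> in infinite dimension.\<close>

definition cdim :: "'a::complex_banach set \<Rightarrow> enat" where
  "cdim M = (if \<exists>B. finite B \<and> M \<subseteq> complex_vector.span B
             then enat (complex_vector.dim M) else \<infinity>)"

text \<open>
  For a subspace \<open>M\<close> of \<open>X\<close> this is the dimension of \<open>X / M\<close>: the images of the elements of \<open>B\<close>
  span the quotient iff \<open>M \<union> B\<close> spans \<open>X\<close>. The infimum of the empty set is \<open>\<infinity>\<close>.
\<close>

definition ccodim :: "'a::complex_banach set \<Rightarrow> enat" where
  "ccodim M = Inf {enat (card B) |B. finite B \<and> complex_vector.span (M \<union> B) = UNIV}"

definition bounded_clinear :: "('a::complex_banach \<Rightarrow> 'b::complex_banach) \<Rightarrow> bool" where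
  "bounded_clinear T \<longleftrightarrow> bounded_linear T \<and> (\<forall>c x. T (scaleC c x) = scaleC c (T x))"

lemma bounded_clinear_map_prod:
  assumes "bounded_clinear S" and "bounded_clinear T"
  shows "bounded_clinear (map_prod S T)"
proof -
  have "bounded_linear (\<lambda>z. (S (fst z), T (snd z)))"
    using assms
    by (intro bounded_linear_Pair bounded_linear_compose[OF _ bounded_linear_fst]
        bounded_linear_compose[OF _ bounded_linear_snd]) (auto simp: bounded_clinear_def)
  moreover have "(\<lambda>z. (S (fst z), T (snd z))) = map_prod S T"
    by auto
  ultimately show ?thesis
    using assms by (auto simp: bounded_clinear_def scaleC_prod_def)
qed

definition shift_op :: "('a::complex_banach \<Rightarrow> 'a) \<Rightarrow> complex \<Rightarrow> 'a \<Rightarrow> 'a" where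
  "shift_op T \<mu> = (\<lambda>x. T x - scaleC \<mu> x)"

definition null_space :: "('a::complex_banach \<Rightarrow> 'a) \<Rightarrow> 'a set" where
  "null_space T = {x. T x = 0}"

definition nullity :: "('a::complex_banach \<Rightarrow> 'a) \<Rightarrow> enat" where
  "nullity T = cdim (null_space T)"

definition defect :: "('a::complex_banach \<Rightarrow> 'a) \<Rightarrow> enat" where
  "defect T = ccodim (range T)"

definition spectrum :: "('a::complex_banach \<Rightarrow> 'a) \<Rightarrow> complex set" where
  "spectrum T = {\<mu>. \<not> (\<exists>R. bounded_clinear R \<and>
      R \<circ> shift_op T \<mu> = id \<and> shift_op T \<mu> \<circ> R = id)}"

definition approx_point_spectrum :: "('a::complex_banach \<Rightarrow> 'a) \<Rightarrow> complex set" where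
  "approx_point_spectrum T = {\<mu>. \<exists>x :: nat \<Rightarrow> 'a.
      (\<forall>n. norm (x n) = 1) \<and> (\<lambda>n. shift_op T \<mu> (x n)) \<longlonglongrightarrow> 0}"

definition iso :: "complex set \<Rightarrow> complex set" where
  "iso A = {\<mu>. \<mu> isolated_in A}"

definition quasinilpotent_part :: "('a::complex_banach \<Rightarrow> 'a) \<Rightarrow> 'a set" where
  "quasinilpotent_part T = {x. (\<lambda>n. root n (norm ((T ^^ n) x))) \<longlonglongrightarrow> 0}"

definition H_operator :: "('a::complex_banach \<Rightarrow> 'a) \<Rightarrow> bool" where
  "H_operator T \<longleftrightarrow>
     (\<forall>\<mu>. \<exists>p::nat. quasinilpotent_part (shift_op T \<mu>) = null_space (shift_op T \<mu> ^^ p))"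

definition upper_semi_Fredholm :: "('a::complex_banach \<Rightarrow> 'a) \<Rightarrow> bool" where
  "upper_semi_Fredholm T \<longleftrightarrow> closed (range T) \<and> nullity T < \<infinity>"

text \<open>
  Meaningful when the nullity is finite, as for upper semi-Fredholm operators; the value is
  \<open>-\<infinity>\<close> if then the defect is infinite.
\<close>

definition fredholm_index :: "('a::complex_banach \<Rightarrow> 'a) \<Rightarrow> ereal" where
  "fredholm_index T = ereal_of_enat (nullity T) - ereal_of_enat (defect T)"

definition upper_semi_Weyl :: "('a::complex_banach \<Rightarrow> 'a) \<Rightarrow> bool" where
  "upper_semi_Weyl T \<longleftrightarrow> upper_semi_Fredholm T \<and> fredholm_index T \<le> 0"

definition upper_semi_Weyl_spectrum :: "('a::complex_banach \<Rightarrow> 'a) \<Rightarrow> complex set" where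
  "upper_semi_Weyl_spectrum T = {\<mu>. \<not> upper_semi_Weyl (shift_op T \<mu>)}"

definition ascent :: "('a::complex_banach \<Rightarrow> 'a) \<Rightarrow> enat" where
  "ascent T = Inf {enat n |n. null_space (T ^^ n) = null_space (T ^^ (n + 1))}"

definition left_pole :: "('a::complex_banach \<Rightarrow> 'a) \<Rightarrow> complex \<Rightarrow> bool" where
  "left_pole T \<mu> \<longleftrightarrow> \<mu> \<in> approx_point_spectrum T \<and>
     (\<exists>p::nat. ascent (shift_op T \<mu>) = enat p \<and> closed (range (shift_op T \<mu> ^^ (p + 1))))"

definition left_poles_finite_rank :: "('a::complex_banach \<Rightarrow> 'a) \<Rightarrow> complex set" where
  "left_poles_finite_rank T = {\<mu>. left_pole T \<mu> \<and> nullity (shift_op T \<mu>) < \<infinity>}"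

definition finite_mult_eigenvalues :: "('a::complex_banach \<Rightarrow> 'a) \<Rightarrow> complex set" where
  "finite_mult_eigenvalues T =
     {\<mu>. 0 < nullity (shift_op T \<mu>) \<and> nullity (shift_op T \<mu>) < \<infinity>}"

definition isolated_finite_mult_eigenvalues :: "('a::complex_banach \<Rightarrow> 'a) \<Rightarrow> complex set" where
  "isolated_finite_mult_eigenvalues T =
     iso (approx_point_spectrum T) \<inter> finite_mult_eigenvalues T"

definition property_z :: "('a::complex_banach \<Rightarrow> 'a) \<Rightarrow> bool" where
  "property_z T \<longleftrightarrow>
     spectrum T - upper_semi_Weyl_spectrum T = isolated_finite_mult_eigenvalues T"

definition property_az :: "('a::complex_banach \<Rightarrow> 'a) \<Rightarrow> bool" where
  "property_az T \<longleftrightarrow>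
     spectrum T - upper_semi_Weyl_spectrum T = left_poles_finite_rank T"

end

theory Submission
  imports Defs
begin

text \<open>
  Write \<open>\<sigma>\<close>, \<open>\<sigma>\<^sub>a\<close> for the spectrum and the approximate point spectrum. For a fixed \<open>(H)\<close>-operator \<open>T\<close> all
  null spaces of powers of \<open>T - \<mu>\<close> lie in the quasinilpotent part, which is one of them; so the
  ascent is finite at each \<open>\<mu>\<close>. Two consequences carry the proof.

  \<^item> Finite ascent forces nullity \<open>\<le>\<close> defect (\<open>nullity_le_defect\<close>), so that upper semi-Weyl and upper
    semi-Fredholm mean the same for \<open>T - \<mu>\<close>. In particular \<open>T - \<mu>\<close> is upper semi-Weyl whenever \<open>\<mu> \<notin> \<sigma>\<^sub>a\<close>,
    for it is then bounded below.

  \<^item> Left poles of finite rank are exactly the points of \<open>\<sigma>\<^sub>a\<close> at which \<open>T - \<mu>\<close> is upper semi-Weyl. This needs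
    that, with finite nullity, the range of an operator is closed iff that of a positive power is
    (\<open>closed_range_funpow_iff\<close>).

  Hence property \<open>(az)\<close> amounts to \<open>\<sigma> = \<sigma>\<^sub>a\<close>. The direct sum is again an \<open>(H)\<close>-operator, and \<open>\<sigma>\<close> and \<open>\<sigma>\<^sub>a\<close> of
  the sum are the unions of those of the summands, which settles property \<open>(az)\<close>.

  Property \<open>(z)\<close> also implies \<open>\<sigma> = \<sigma>\<^sub>a\<close>. The obstacle is that an isolated eigenvalue of the direct sum
  may lie in the spectrum of a summand for which it is no eigenvalue. This does not happen for
  \<open>(H)\<close>-operators: at an isolated point of the spectrum an injective \<open>T - \<mu>\<close> has trivial quasinilpotent part,
  so the Riesz projection vanishes and the constant term of the Laurent series of the resolvent is a bounded
  left inverse (\<open>bounded_below_if_quasinilpotent_part_trivial\<close>). Therefore, given property \<open>(z)\<close>, \<open>T - \<mu>\<close> is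
  upper semi-Fredholm iff its nullity is finite and \<open>\<mu>\<close> is isolated in \<open>\<sigma>\<^sub>a\<close> in case it belongs to
  \<open>\<sigma>\<^sub>a\<close> (\<open>property_z_upper_semi_Fredholm_iff\<close>), and this condition is inherited by direct sums.
\<close>

section \<open>Complex scalars and bounded complex-linear operators\<close>

lemma bounded_clinear_bounded_linear: "bounded_clinear T \<Longrightarrow> bounded_linear T"
  by (simp add: bounded_clinear_def)

lemma bounded_clinear_scaleC: "bounded_clinear T \<Longrightarrow> T (scaleC c x) = scaleC c (T x)"
  by (simp add: bounded_clinear_def)

lemma bounded_bilinear_scaleC:
  "bounded_bilinear (scaleC :: complex \<Rightarrow> 'a \<Rightarrow> 'a::complex_banach)"
proof
  fix a b r and x y :: 'a
  show "scaleC (a + b) x = scaleC a x + scaleC b x" by (rule scaleC_add_left)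
  show "scaleC a (x + y) = scaleC a x + scaleC a y" by (rule scaleC_add_right)
  show "scaleC (r *\<^sub>R a) x = r *\<^sub>R scaleC a x"
    by (simp add: scaleR_conv_of_real scaleC_scaleC flip: scaleC_of_real)
  show "scaleC a (r *\<^sub>R x) = r *\<^sub>R scaleC a x"
    by (simp add: scaleC_scaleC mult.commute flip: scaleC_of_real)
  show "\<exists>K. \<forall>(a::complex) x::'a. norm (scaleC a x) \<le> norm a * norm x * K"
    by (rule exI[of _ 1]) (simp add: norm_scaleC)
qed

lemmas scaleC_tendsto = bounded_bilinear.tendsto[OF bounded_bilinear_scaleC]
lemmas scaleC_continuous_on = bounded_bilinear.continuous_on[OF bounded_bilinear_scaleC]
lemmas bounded_linear_scaleC_right =
  bounded_bilinear.bounded_linear_right[OF bounded_bilinear_scaleC]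
lemmas bounded_linear_scaleC_left =
  bounded_bilinear.bounded_linear_left[OF bounded_bilinear_scaleC]

lemma bounded_clinear_shift_op:
  assumes "bounded_clinear T"
  shows "bounded_clinear (shift_op T \<mu>)"
  unfolding bounded_clinear_def shift_op_def
  using assms
  by (auto simp: bounded_clinear_def scaleC_scaleC mult.commute
      complex_vector.scale_right_diff_distrib
      intro!: bounded_linear_sub bounded_linear_scaleC_right)

lemma shift_op_shift_op: "shift_op (shift_op T \<nu>) \<mu> = shift_op T (\<nu> + \<mu>)"
  by (auto simp: shift_op_def scaleC_add_left)

section \<open>Isolated points of the spectrum\<close>

lemma continuous_on_rcis [continuous_intros]:
  assumes "continuous_on S f" "continuous_on S g"
  shows "continuous_on S (\<lambda>x. rcis (f x) (g x))"
  unfolding rcis_def cis_conv_exp using assms by (intro continuous_intros)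

lemma has_vector_derivative_rcis_radius:
  "((\<lambda>r. rcis r t) has_vector_derivative cis t) (at r within S)"
  unfolding rcis_def
  by (auto intro!: derivative_eq_intros simp: has_vector_derivative_def scaleR_conv_of_real)

lemma has_vector_derivative_rcis_angle:
  "((\<lambda>t. rcis r (k * t)) has_vector_derivative \<i> * k * rcis r (k * t)) (at t within S)"
proof -
  have "((\<lambda>z. r * exp (\<i> * (k * z))) has_field_derivative
      \<i> * k * (r * exp (\<i> * (k * t)))) (at (of_real t))"
    by (auto intro!: derivative_eq_intros)
  from has_vector_derivative_real_field[OF this] show ?thesis
    by (simp add: rcis_def cis_conv_exp)
qed

lemma has_integral_rcis_power:
  fixes r :: real
  assumes "n > 0"
  shows "((\<lambda>t. rcis r t ^ n) has_integral 0) {0..2*pi}"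
proof -
  have "((\<lambda>t. \<i> * of_nat n * rcis (r^n) (real n * t)) has_integral
      rcis (r^n) (real n * (2*pi)) - rcis (r^n) (real n * 0)) {0..2*pi}"
    using has_vector_derivative_rcis_angle[where k = "real n"]
    by (intro fundamental_theorem_of_calculus) auto
  moreover have "rcis (r^n) (real n * (2*pi)) = rcis (r^n) (real n * 0)"
    using cis_multiple_2pi[of "real n"] by (simp add: rcis_def mult_ac)
  ultimately have "((\<lambda>t. \<i> * of_nat n * rcis (r^n) (real n * t)) has_integral 0) {0..2*pi}"
    by simp
  from has_integral_mult_right[OF this, of "1 / (\<i> * of_nat n)"]
  show ?thesis using assms by (simp add: DeMoivre2)
qed

text \<open>
The situation at an isolated point of the spectrum, moved to the origin: \<open>G z\<close> inverts
\<open>A - z\<close> for \<open>0 < cmod z < R\<close>.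
\<close>

locale punctured_resolvent =
  fixes A :: "'a::complex_banach \<Rightarrow> 'a" and G :: "complex \<Rightarrow> 'a \<Rightarrow> 'a" and R :: real
  assumes A: "bounded_clinear A"
    and G: "\<And>z. 0 < cmod z \<Longrightarrow> cmod z < R \<Longrightarrow> bounded_clinear (G z)"
    and G_left: "\<And>z x. 0 < cmod z \<Longrightarrow> cmod z < R \<Longrightarrow> G z (A x - scaleC z x) = x"
    and G_right: "\<And>z x. 0 < cmod z \<Longrightarrow> cmod z < R \<Longrightarrow> A (G z x) - scaleC z (G z x) = x"
begin

definition disc :: "complex set" where "disc = {z. 0 < cmod z \<and> cmod z < R}"

lemma open_disc: "open disc"
proof -
  have "disc = ball 0 R - {0}" by (auto simp: disc_def)
  then show ?thesis by (simp add: open_delete)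
qed

lemma bounded_linear_G: "z \<in> disc \<Longrightarrow> bounded_linear (G z)"
  using G by (simp add: disc_def bounded_clinear_bounded_linear)

lemma A_G: "z \<in> disc \<Longrightarrow> A (G z x) = x + scaleC z (G z x)"
  using G_right[of z x] by (simp add: disc_def algebra_simps)

lemma G_A: "z \<in> disc \<Longrightarrow> G z (A x) = x + scaleC z (G z x)"
proof -
  assume z: "z \<in> disc"
  interpret Gz: bounded_linear "G z" using bounded_linear_G z .
  have "G z (A x) - scaleC z (G z x) = x"
    using G_left[of z x] z G[of z] by (simp add: disc_def Gz.diff bounded_clinear_scaleC)
  then show ?thesis by (simp add: algebra_simps)
qed

text \<open>
The first resolvent identity: it follows from evaluating \<open>G w (A (G z x))\<close> with either of the two
inverses. Continuity and differentiability of the resolvent both rest on it.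
\<close>

lemma resolvent_equation:
  assumes "w \<in> disc" "z \<in> disc"
  shows "G w x - G z x = scaleC (w - z) (G w (G z x))"
proof -
  interpret Gw: bounded_linear "G w" using bounded_linear_G assms(1) .
  have "G w (A (G z x)) = G z x + scaleC w (G w (G z x))"
    using G_A assms by blast
  moreover have "G w (A (G z x)) = G w x + scaleC z (G w (G z x))"
    using assms G[of w] by (simp add: A_G Gw.add bounded_clinear_scaleC disc_def)
  ultimately show ?thesis
    by (simp add: complex_vector.scale_left_diff_distrib algebra_simps)
qed

text \<open>
Near \<open>z\<close> the identity \<open>G w x = G z x + (w - z) G z (G w x)\<close> bounds \<open>G w x\<close> by \<open>K \<parallel>x\<parallel>\<close> plus half of
itself, where \<open>K\<close> bounds \<open>G z\<close>.
\<close>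

lemma G_locally_bounded:
  assumes z: "z \<in> disc"
  shows "\<exists>K d. d > 0 \<and> (\<forall>w\<in>disc. \<forall>x. cmod (w - z) < d \<longrightarrow> norm (G w x) \<le> K * norm x)"
proof -
  obtain K where K: "K > 0" "\<And>x. norm (G z x) \<le> norm x * K"
    using bounded_linear.pos_bounded[OF bounded_linear_G[OF z]] by blast
  have "norm (G w x) \<le> 2 * K * norm x" if w: "w \<in> disc" "cmod (w - z) < 1 / (2 * K)" for w x
  proof -
    have "G w x = G z x + scaleC (w - z) (G z (G w x))"
      using resolvent_equation[OF z w(1), of x]
      by (simp add: complex_vector.scale_left_diff_distrib algebra_simps)
    then have "norm (G w x) \<le> norm (G z x) + cmod (w - z) * norm (G z (G w x))"
      by (metis norm_scaleC norm_triangle_ineq)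
    also have "\<dots> \<le> norm x * K + 1 / (2 * K) * (norm (G w x) * K)"
      using w K by (intro add_mono mult_mono) auto
    also have "\<dots> = norm x * K + norm (G w x) / 2" using K by (simp add: field_simps)
    finally show ?thesis by (simp add: field_simps)
  qed
  moreover have "1 / (2 * K) > 0" using K by simp
  ultimately show ?thesis by blast
qed

lemma tendsto_G:
  assumes f: "(f \<longlongrightarrow> z) F" and g: "(g \<longlongrightarrow> x) F" and z: "z \<in> disc"
  shows "((\<lambda>t. G (f t) (g t)) \<longlongrightarrow> G z x) F"
proof -
  obtain K d where d: "d > 0"
    and K: "\<forall>w\<in>disc. \<forall>x. cmod (w - z) < d \<longrightarrow> norm (G w x) \<le> K * norm x"
    using G_locally_bounded[OF z] by blast
  have ev: "eventually (\<lambda>t. f t \<in> disc \<and> cmod (f t - z) < d) F"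
    using topological_tendstoD[OF f open_disc z] tendstoD[OF f d]
    by eventually_elim (auto simp: dist_norm)
  have "eventually (\<lambda>t. norm (G (f t) (g t) - G z x)
      \<le> K * norm (g t - x) + cmod (f t - z) * (K * norm (G z x))) F"
    using ev
  proof eventually_elim
    case (elim t)
    have "G (f t) (g t) - G z x = G (f t) (g t - x) + (G (f t) x - G z x)"
      using bounded_linear_G[of "f t"] elim by (simp add: bounded_linear_def linear_diff)
    also have "\<dots> = G (f t) (g t - x) + scaleC (f t - z) (G (f t) (G z x))"
      using resolvent_equation elim z by simp
    finally have "norm (G (f t) (g t) - G z x)
        \<le> norm (G (f t) (g t - x)) + cmod (f t - z) * norm (G (f t) (G z x))"
      by (metis norm_scaleC norm_triangle_ineq)
    then show ?case
      using K elim by (smt (verit) mult_left_mono norm_ge_zero)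
  qed
  moreover have "((\<lambda>t. K * norm (g t - x) + cmod (f t - z) * (K * norm (G z x))) \<longlongrightarrow>
      K * norm (x - x) + cmod (z - z) * (K * norm (G z x))) F"
    by (intro tendsto_intros f g)
  then have "((\<lambda>t. K * norm (g t - x) + cmod (f t - z) * (K * norm (G z x))) \<longlongrightarrow> 0) F"
    by simp
  ultimately have "((\<lambda>t. G (f t) (g t) - G z x) \<longlongrightarrow> 0) F"
    by (rule Lim_null_comparison)
  then show ?thesis using Lim_null by blast
qed

lemma continuous_on_G:
  assumes "continuous_on S f" "continuous_on S g" "f ` S \<subseteq> disc"
  shows "continuous_on S (\<lambda>t. G (f t) (g t))"
  using assms unfolding continuous_on_def by (auto intro!: tendsto_G)

lemma has_derivative_G:
  assumes z: "z \<in> disc"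
  shows "((\<lambda>z. G z y) has_derivative (\<lambda>h. scaleC h (G z (G z y)))) (at z)"
  unfolding has_derivative_at2
proof (intro conjI bounded_linear_scaleC_left)
  let ?u = "G z y"
  have "eventually (\<lambda>w. norm ((1 / norm (w - z)) *\<^sub>R
      (G w y - (G z y + scaleC (w - z) (G z ?u)))) \<le> norm (G w ?u - G z ?u)) (at z)"
    using eventually_at_in_open'[OF open_disc z] eventually_neq_at_within[of z z UNIV]
  proof eventually_elim
    case (elim w)
    have "G w y - (G z y + scaleC (w - z) (G z ?u)) = scaleC (w - z) (G w ?u - G z ?u)"
      using resolvent_equation[of w z y] elim z
      by (simp add: complex_vector.scale_right_diff_distrib algebra_simps)
    then show ?case using elim by (simp add: norm_scaleC)
  qed
  moreover have "((\<lambda>w. norm (G w ?u - G z ?u)) \<longlongrightarrow> norm (G z ?u - G z ?u)) (at z)"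
    by (intro tendsto_intros tendsto_G z)
  then have "((\<lambda>w. norm (G w ?u - G z ?u)) \<longlongrightarrow> 0) (at z)" by simp
  ultimately show "((\<lambda>w. (1 / norm (w - z)) *\<^sub>R
      (G w y - (G z y + scaleC (w - z) (G z ?u)))) \<longlongrightarrow> 0) (at z)"
    by (rule Lim_null_comparison)
qed

text \<open>
This is the complex derivative of \<open>z \<mapsto> z G z y\<close>.
\<close>

definition deriv_zG :: "'a \<Rightarrow> complex \<Rightarrow> 'a" where
  "deriv_zG y z = G z y + scaleC z (G z (G z y))"

lemma has_vector_derivative_zG:
  assumes c: "(c has_vector_derivative c') (at t within S)" and "c t \<in> disc"
  shows "((\<lambda>t. scaleC (c t) (G (c t) y)) has_vector_derivative scaleC c' (deriv_zG y (c t)))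
      (at t within S)"
proof -
  have "((\<lambda>z. scaleC z (G z y)) has_derivative
      (\<lambda>h. scaleC (c t) (scaleC h (G (c t) (G (c t) y))) + scaleC h (G (c t) y))) (at (c t))"
    by (rule bounded_bilinear.FDERIV[OF bounded_bilinear_scaleC has_derivative_ident
          has_derivative_G[OF assms(2)]])
  then have "((\<lambda>z. scaleC z (G z y)) has_derivative (\<lambda>h. scaleC h (deriv_zG y (c t)))) (at (c t))"
    by (simp add: deriv_zG_def scaleC_add_right scaleC_scaleC mult.commute add.commute)
  from has_derivative_compose[OF c[unfolded has_vector_derivative_def] this]
  show ?thesis
    by (simp add: has_vector_derivative_def bounded_bilinear.scaleR_left[OF bounded_bilinear_scaleC])
qed

lemma rcis_in_disc: "0 < r \<Longrightarrow> r < R \<Longrightarrow> rcis r t \<in> disc"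
  by (simp add: disc_def)

text \<open>
Up to sign and normalization this is the Riesz projection \<open>1/(2 \<pi> \<i>) \<integral> (z - A)\<^sup>-\<^sup>1 y dz\<close> over the circle
\<open>\<bar>z\<bar> = r\<close>, written as a real integral over the angle because \<open>dz = \<i> z dt\<close>.
\<close>

definition circle_int :: "real \<Rightarrow> 'a \<Rightarrow> 'a" where
  "circle_int r y = integral {0..2*pi} (\<lambda>t. scaleC (rcis r t) (G (rcis r t) y))"

lemma circle_int_has_integral:
  assumes "0 < r" "r < R"
  shows "((\<lambda>t. scaleC (rcis r t) (G (rcis r t) y)) has_integral circle_int r y) {0..2*pi}"
  unfolding circle_int_def
  by (intro integrable_integral integrable_continuous_real scaleC_continuous_on
      continuous_on_G continuous_intros) (auto simp: rcis_in_disc assms)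

text \<open>
Instead of deforming contours one differentiates in the radius. For a holomorphic integrand the
radial derivative is a constant multiple of the angular derivative, whose integral over a full turn
vanishes.
\<close>

lemma circle_int_radius_independent:
  assumes "0 < r" "r < R" "0 < s" "s < R"
  shows "circle_int r y = circle_int s y"
proof -
  let ?U = "{0<..<R}"
  have "((\<lambda>r. integral (cbox 0 (2*pi)) (\<lambda>t. scaleC (rcis r t) (G (rcis r t) y)))
      has_vector_derivative 0) (at q within ?U)" if q: "q \<in> ?U" for q
  proof -
    have "((\<lambda>t. scaleC (\<i> * rcis q t) (deriv_zG y (rcis q t))) has_integral
        scaleC (rcis q (2*pi)) (G (rcis q (2*pi)) y) - scaleC (rcis q 0) (G (rcis q 0) y)) {0..2*pi}"
      using has_vector_derivative_rcis_angle[where k = 1] q rcis_in_disc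
      by (intro fundamental_theorem_of_calculus has_vector_derivative_zG) auto
    moreover have "rcis q (2*pi) = rcis q 0" by (simp add: rcis_def)
    ultimately have "((\<lambda>t. scaleC (\<i> * rcis q t) (deriv_zG y (rcis q t))) has_integral 0) {0..2*pi}"
      by simp
    from has_integral_linear[OF this bounded_linear_scaleC_right[of "1 / (\<i> * q)"]]
    have "((\<lambda>t. scaleC (cis t) (deriv_zG y (rcis q t))) has_integral 0) {0..2*pi}"
      using q by (simp add: o_def scaleC_scaleC rcis_def)
    then have *: "integral (cbox 0 (2*pi)) (\<lambda>t. scaleC (cis t) (deriv_zG y (rcis q t))) = 0"
      by auto
    have "((\<lambda>r. integral (cbox 0 (2*pi)) (\<lambda>t. scaleC (rcis r t) (G (rcis r t) y)))
      has_vector_derivative integral (cbox 0 (2*pi)) (\<lambda>t. scaleC (cis t) (deriv_zG y (rcis q t))))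
      (at q within ?U)"
    proof (rule leibniz_rule_vector_derivative[OF _ _ _ q])
      fix x t assume "x \<in> ?U"
      then show "((\<lambda>x. scaleC (rcis x t) (G (rcis x t) y)) has_vector_derivative
          scaleC (cis t) (deriv_zG y (rcis x t))) (at x within ?U)"
        by (intro has_vector_derivative_zG has_vector_derivative_rcis_radius rcis_in_disc) auto
    next
      fix x assume "x \<in> ?U"
      then show "(\<lambda>t. scaleC (rcis x t) (G (rcis x t) y)) integrable_on cbox 0 (2*pi)"
        using circle_int_has_integral[of x y] by (auto simp: has_integral_integrable)
    next
      have "(\<lambda>p. rcis (fst p) (snd p)) ` (?U \<times> cbox 0 (2*pi)) \<subseteq> disc"
        using rcis_in_disc by auto
      then show "continuous_on (?U \<times> cbox 0 (2*pi)) (\<lambda>(x, t). scaleC (cis t) (deriv_zG y (rcis x t)))"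
        unfolding deriv_zG_def split_beta
        by (intro scaleC_continuous_on continuous_on_G continuous_intros)
    qed simp
    then show ?thesis using * by simp
  qed
  then show ?thesis
  proof (rule has_vector_derivative_zero_constant[OF convex_real_interval(8)])
    fix c assume "\<And>r. r \<in> ?U \<Longrightarrow>
      integral (cbox 0 (2*pi)) (\<lambda>t. scaleC (rcis r t) (G (rcis r t) y)) = c"
    then have "circle_int r y = c" "circle_int s y = c"
      using assms unfolding circle_int_def by (simp_all add: box_real)
    then show "circle_int r y = circle_int s y" by simp
  qed
qed

text \<open>
Applying \<open>A\<close> multiplies the integrand by \<open>z\<close>: since \<open>A (G z y) = y + z G z y\<close>, the difference is an
integral of \<open>z\<^sup>n y\<close> with \<open>n > 0\<close> over the circle, which is zero.
\<close>

lemma power_circle_int_has_integral: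
  assumes r: "0 < r" "r < R"
  shows "((\<lambda>t. scaleC (rcis r t ^ Suc m) (G (rcis r t) y)) has_integral (A ^^ m) (circle_int r y)) {0..2*pi}"
proof (induction m)
  case 0
  then show ?case using circle_int_has_integral[OF r] by simp
next
  case (Suc m)
  have 1: "((\<lambda>t. A (scaleC (rcis r t ^ Suc m) (G (rcis r t) y))) has_integral
      (A ^^ Suc m) (circle_int r y)) {0..2*pi}"
    using has_integral_linear[OF Suc bounded_clinear_bounded_linear[OF A]] by (simp add: o_def)
  have 2: "((\<lambda>t. scaleC (rcis r t ^ Suc m) y) has_integral 0) {0..2*pi}"
    using has_integral_linear[OF has_integral_rcis_power[of "Suc m" r]
        bounded_linear_scaleC_left[of y]] by (simp add: o_def)
  have "A (scaleC (rcis r t ^ Suc m) (G (rcis r t) y)) - scaleC (rcis r t ^ Suc m) y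
      = scaleC (rcis r t ^ Suc (Suc m)) (G (rcis r t) y)" for t
    using A_G[OF rcis_in_disc[OF r]] A
    by (simp add: bounded_clinear_scaleC scaleC_add_right scaleC_scaleC mult_ac)
  then show ?case using has_integral_diff[OF 1 2] by simp
qed

lemma G_bounded_on_circle:
  assumes r: "0 < r" "r < R"
  shows "\<exists>K>0. \<forall>t\<in>{0..2*pi}. \<forall>x. norm (G (rcis r t) x) \<le> K * norm x"
proof -
  let ?c = "rcis r ` {0..2*pi}"
  have comp: "compact ?c"
    by (intro compact_continuous_image continuous_intros) auto
  have c_disc: "?c \<subseteq> disc" using rcis_in_disc[OF r] by auto
  have "\<forall>z\<in>?c. \<exists>p. snd p > 0 \<and>
      (\<forall>w\<in>disc. \<forall>x. cmod (w - z) < snd p \<longrightarrow> norm (G w x) \<le> fst p * norm x)"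
    using G_locally_bounded c_disc by simp blast
  from bchoice[OF this] obtain p where d: "\<forall>z\<in>?c. snd (p z) > 0"
    and K: "\<forall>z\<in>?c. \<forall>w\<in>disc. \<forall>x. cmod (w - z) < snd (p z) \<longrightarrow> norm (G w x) \<le> fst (p z) * norm x"
    by blast
  \<comment> \<open>the first component of \<open>p z\<close> is the local bound, the second the radius on which it holds\<close>
  have "?c \<subseteq> (\<Union>z\<in>?c. ball z (snd (p z)))" 
  proof
    fix z assume "z \<in> ?c"
    moreover from this have "z \<in> ball z (snd (p z))" using d by (meson centre_in_ball)
    ultimately show "z \<in> (\<Union>z\<in>?c. ball z (snd (p z)))" by blast
  qed
  then obtain C where C: "C \<subseteq> ?c" "finite C" "?c \<subseteq> (\<Union>z\<in>C. ball z (snd (p z)))"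
    using compactE_image[OF comp, of ?c "\<lambda>z. ball z (snd (p z))"] open_ball by blast
  define L where "L = 1 + (\<Sum>z\<in>C. \<bar>fst (p z)\<bar>)"
  have L: "L > 0" unfolding L_def by (simp add: add_pos_nonneg sum_nonneg)
  have "norm (G (rcis r t) x) \<le> L * norm x" if t: "t \<in> {0..2*pi}" for t x
  proof -
    obtain z where z: "z \<in> C" "rcis r t \<in> ball z (snd (p z))" using C(3) t by blast
    have "cmod (rcis r t - z) < snd (p z)"
      using z(2) by (simp add: dist_norm norm_minus_commute)
    then have "norm (G (rcis r t) x) \<le> fst (p z) * norm x"
      using K z(1) C(1) rcis_in_disc[OF r] by blast
    also have "\<dots> \<le> L * norm x"
    proof (intro mult_right_mono)
      show "fst (p z) \<le> L"
        using member_le_sum[of z C "\<lambda>z. \<bar>fst (p z)\<bar>"] z C(2) unfolding L_def by simp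
    qed simp
    finally show ?thesis .
  qed
  with L show ?thesis by blast
qed

lemma norm_power_circle_int_le:
  assumes r: "0 < r" "r < R"
  shows "\<exists>C>0. \<forall>m. norm ((A ^^ m) (circle_int r y)) \<le> C * r ^ m"
proof -
  obtain K where K: "K > 0" "\<forall>t\<in>{0..2*pi}. \<forall>x. norm (G (rcis r t) x) \<le> K * norm x"
    using G_bounded_on_circle[OF r] by blast
  have "norm ((A ^^ m) (circle_int r y)) \<le> (r ^ Suc m * (K * norm y)) * (2 * pi)" for m
  proof -
    have "norm ((A ^^ m) (circle_int r y)) \<le>
        (r ^ Suc m * (K * norm y)) * measure lborel (cbox 0 (2 * pi))"
      using power_circle_int_has_integral[OF r] K r
      by (intro has_integral_bound[where f = "\<lambda>t. scaleC (rcis r t ^ Suc m) (G (rcis r t) y)"])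
        (auto simp: norm_scaleC norm_mult norm_power intro!: mult_left_mono mult_nonneg_nonneg)
    then show ?thesis by simp
  qed
  then have bound: "norm ((A ^^ m) (circle_int r y)) \<le> (r * K * (norm y + 1) * 2 * pi) * r ^ m" for m
  proof -
    have "(r ^ Suc m * (K * norm y)) * (2 * pi) \<le> (r ^ Suc m * (K * (norm y + 1))) * (2 * pi)"
      using r K by (intro mult_right_mono mult_left_mono) auto
    also have "\<dots> = (r * K * (norm y + 1) * 2 * pi) * r ^ m" by simp
    finally show ?thesis
      using \<open>\<And>m. norm ((A ^^ m) (circle_int r y)) \<le> _\<close>[of m] by linarith
  qed
  have "r * K * (norm y + 1) * 2 * pi > 0"
    using r K by (simp add: add_nonneg_pos)
  with bound show ?thesis by blast
qed

text \<open>
The growth of \<open>A\<^sup>m\<close> on the integral is at most \<open>C r\<^sup>m\<close>, and \<open>r\<close> may be taken as small as one likes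
without changing the integral.
\<close>

lemma circle_int_in_quasinilpotent_part:
  assumes r: "0 < r" "r < R"
  shows "circle_int r y \<in> quasinilpotent_part A"
proof -
  let ?a = "\<lambda>n. root n (norm ((A ^^ n) (circle_int r y)))"
  have "?a \<longlonglongrightarrow> 0"
  proof (rule LIMSEQ_I)
    fix e :: real assume e: "e > 0"
    define s where "s = min (r) (e / 2)"
    have s: "0 < s" "s < R" "s < e" using r e by (auto simp: s_def)
    obtain C where C: "C > 0" "\<forall>m. norm ((A ^^ m) (circle_int s y)) \<le> C * s ^ m"
      using norm_power_circle_int_le[OF s(1,2)] by blast
    have "(\<lambda>n. root n C * s) \<longlonglongrightarrow> 1 * s"
      by (intro tendsto_intros LIMSEQ_root_const C)
    then have "eventually (\<lambda>n. root n C * s < e) sequentially"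
      using order_tendstoD(2)[of _ "1 * s" _ e] s by simp
    then have "eventually (\<lambda>n. norm (?a n - 0) < e) sequentially"
      using eventually_gt_at_top[of 0]
    proof eventually_elim
      case (elim n)
      have "?a n \<le> root n (C * s ^ n)"
        using C(2)[rule_format, of n] elim(2) circle_int_radius_independent[OF r s(1,2), of y]
        by (simp add: real_root_le_mono)
      also have "\<dots> = root n C * s"
        using elim s by (simp add: real_root_mult real_root_power_cancel)
      finally show ?case using elim by simp
    qed
    then show "\<exists>N. \<forall>n\<ge>N. norm (?a n - 0) < e" by (simp add: eventually_sequentially)
  qed
  then show ?thesis by (simp add: quasinilpotent_part_def)
qed

text \<open>
If the quasinilpotent part is zero, all the circle integrals vanish, so \<open>z \<mapsto> G z\<close> has no \<open>1/z\<close> term.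
Its constant term \<open>1/(2 \<pi>) \<integral> G z dt\<close> is then a bounded left inverse of \<open>A\<close>.
\<close>

lemma bounded_below_if_quasinilpotent_part_trivial:
  assumes R: "R > 0" and H0: "quasinilpotent_part A = {0}"
  shows "\<exists>c>0. \<forall>x. c * norm x \<le> norm (A x)"
proof -
  define r where "r = R / 2"
  have r: "0 < r" "r < R" using R by (auto simp: r_def)
  obtain K where K: "K > 0" "\<forall>t\<in>{0..2*pi}. \<forall>x. norm (G (rcis r t) x) \<le> K * norm x"
    using G_bounded_on_circle[OF r] by blast
  have "norm x \<le> K * norm (A x)" for x
  proof -
    have "circle_int r x = 0" using circle_int_in_quasinilpotent_part[OF r] H0 by blast
    then have "((\<lambda>t. scaleC (rcis r t) (G (rcis r t) x)) has_integral 0) {0..2*pi}"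
      using circle_int_has_integral[OF r, of x] by simp
    from has_integral_add[OF has_integral_const_real[of x 0 "2*pi"] this]
    have "((\<lambda>t. G (rcis r t) (A x)) has_integral (2*pi) *\<^sub>R x) {0..2*pi}"
      using G_A[OF rcis_in_disc[OF r]] by simp
    then have "norm ((2*pi) *\<^sub>R x) \<le> (K * norm (A x)) * measure lborel (cbox 0 (2*pi))"
      using K by (intro has_integral_bound[where f = "\<lambda>t. G (rcis r t) (A x)"]) auto
    then show ?thesis by simp
  qed
  then have "1 / K * norm x \<le> norm (A x)" for x
    using K(1) by (simp add: field_simps)
  moreover have "1 / K > 0" using K(1) by simp
  ultimately show ?thesis by blast
qed

end

section \<open>Nullity and defect of operators with finite ascent\<close>

lemma bounded_clinear_linear:
  "bounded_clinear T \<Longrightarrow> Vector_Spaces.linear scaleC scaleC T"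
  unfolding Vector_Spaces.linear_iff bounded_clinear_def
  by (intro conjI complex_vector.vector_space_axioms) (auto simp: linear_add bounded_linear.linear)

lemma bounded_clinear_funpow:
  fixes T :: "'a::complex_banach \<Rightarrow> 'a"
  shows "bounded_clinear T \<Longrightarrow> bounded_clinear (T ^^ n)"
proof (induction n)
  case 0
  have "T ^^ 0 = (\<lambda>x. x)" by auto
  then show ?case by (simp add: bounded_clinear_def id_def bounded_linear_ident)
next
  case (Suc n)
  then show ?case
    by (auto simp: bounded_clinear_def intro: bounded_linear_compose[of T "T ^^ n"])
qed

text \<open>
Only finiteness of dimensions enters most arguments, and the guard in \<^const>\<open>cdim\<close> is this predicate.
\<close>

definition finite_dimensional :: "'a::complex_banach set \<Rightarrow> bool" where
  "finite_dimensional M \<longleftrightarrow> (\<exists>B. finite B \<and> M \<subseteq> complex_vector.span B)"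

lemma cdim_less_infinity_iff: "cdim M < \<infinity> \<longleftrightarrow> finite_dimensional M"
  by (simp add: cdim_def finite_dimensional_def)

lemma finite_dimensional_subset: "finite_dimensional M \<Longrightarrow> N \<subseteq> M \<Longrightarrow> finite_dimensional N"
  unfolding finite_dimensional_def by blast

lemma finite_dimensional_basis:
  assumes "finite_dimensional M"
  obtains B where "B \<subseteq> M" "finite B" "complex_vector.independent B" "M \<subseteq> complex_vector.span B"
    "card B = complex_vector.dim M"
proof -
  obtain B where B: "B \<subseteq> M" "complex_vector.independent B" "M \<subseteq> complex_vector.span B"
      "card B = complex_vector.dim M"
    by (rule complex_vector.basis_exists)
  moreover obtain C where "finite C" "M \<subseteq> complex_vector.span C"
    using assms by (auto simp: finite_dimensional_def)
  ultimately have "finite B"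
    using complex_vector.independent_span_bound[of C B] by blast
  with B show thesis using that by blast
qed

lemma cdim_eq_0_iff: "cdim M = 0 \<longleftrightarrow> M \<subseteq> {0}"
proof
  assume 0: "cdim M = 0"
  then have "finite_dimensional M" by (simp flip: cdim_less_infinity_iff)
  then obtain B where "finite B" "M \<subseteq> complex_vector.span B" "card B = complex_vector.dim M"
    by (rule finite_dimensional_basis)
  with 0 show "M \<subseteq> {0}"
    by (auto simp: cdim_def zero_enat_def split: if_splits)
next
  assume "M \<subseteq> {0}"
  then have M: "M \<subseteq> complex_vector.span {}" by simp
  then have "complex_vector.dim M = 0"
    using complex_vector.dim_le_card[OF M] by simp
  with M show "cdim M = 0"
    unfolding cdim_def zero_enat_def by (auto intro!: exI[of _ "{}"])
qed

lemma subspace_null_space: "bounded_clinear T \<Longrightarrow> complex_vector.subspace (null_space T)"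
  using module_hom.subspace_kernel[OF module_hom_linearI[OF bounded_clinear_linear]]
  unfolding null_space_def by blast

text \<open>
The preimage of \<open>V\<close> is spanned by the null space together with preimages of a basis of
\<open>V \<inter> range T\<close>. Iterated, this makes all null spaces of powers finite-dimensional.
\<close>

lemma finite_dimensional_vimage:
  assumes T: "bounded_clinear T" and N: "finite_dimensional (null_space T)"
    and V: "finite_dimensional V"
  shows "finite_dimensional {x. T x \<in> V}"
proof -
  interpret T: Vector_Spaces.linear scaleC scaleC T by (rule bounded_clinear_linear[OF T])
  obtain B where B: "finite B" "null_space T \<subseteq> complex_vector.span B"
    using N by (auto simp: finite_dimensional_def)
  have "finite_dimensional (V \<inter> range T)"
    by (rule finite_dimensional_subset[OF V]) auto
  then obtain E where E: "E \<subseteq> V \<inter> range T" "finite E" "V \<inter> range T \<subseteq> complex_vector.span E"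
    by (rule finite_dimensional_basis)
  have "\<forall>e\<in>E. \<exists>x. T x = e" using E(1) by auto
  then obtain g where g: "\<forall>e\<in>E. T (g e) = e" by metis
  have "x \<in> complex_vector.span (B \<union> g ` E)" if x: "T x \<in> V" for x
  proof -
    have "T ` g ` E = E" using g by (auto simp: image_iff)
    then have "T x \<in> T ` complex_vector.span (g ` E)"
      using T.span_image[of "g ` E"] E(3) x by auto
    then obtain y where y: "y \<in> complex_vector.span (g ` E)" "T x = T y" by auto
    have "x - y \<in> null_space T" using y by (simp add: null_space_def T.diff)
    with B(2) have "x - y \<in> complex_vector.span (B \<union> g ` E)"
      using complex_vector.span_mono[of B "B \<union> g ` E"] by blast
    moreover have "y \<in> complex_vector.span (B \<union> g ` E)"
      using complex_vector.span_mono[of "g ` E" "B \<union> g ` E"] y(1) by blast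
    ultimately have "(x - y) + y \<in> complex_vector.span (B \<union> g ` E)"
      by (rule complex_vector.span_add)
    then show ?thesis by simp
  qed
  then show ?thesis
    unfolding finite_dimensional_def using B(1) E(2) by (intro exI[of _ "B \<union> g ` E"]) auto
qed

lemma finite_dimensional_null_space_funpow:
  assumes T: "bounded_clinear T" and N: "finite_dimensional (null_space T)"
  shows "finite_dimensional (null_space (T ^^ n))"
proof (induction n)
  case 0
  then show ?case by (auto simp: null_space_def finite_dimensional_def)
next
  case (Suc n)
  have "null_space (T ^^ Suc n) = {x. T x \<in> null_space (T ^^ n)}"
    unfolding funpow_Suc_right by (simp add: null_space_def)
  then show ?case using finite_dimensional_vimage[OF T N Suc] by (simp only:)
qed

lemma independent_span_Int_span:
  assumes "complex_vector.independent (E \<union> F)" "E \<inter> F = {}"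
    and x: "x \<in> complex_vector.span E" "x \<in> complex_vector.span F"
  shows "x = 0"
proof -
  let ?r = "complex_vector.representation"
  have "?r (E \<union> F) x = ?r E x"
    by (rule complex_vector.representation_extend[OF assms(1) x(1)]) simp
  moreover have "?r (E \<union> F) x = ?r F x"
    by (rule complex_vector.representation_extend[OF assms(1) x(2)]) simp
  ultimately have r: "?r (E \<union> F) x v = ?r E x v" "?r (E \<union> F) x v = ?r F x v" for v
    by simp_all
  then have 0: "?r (E \<union> F) x v = 0" for v
    using complex_vector.representation_ne_zero[of E x v]
      complex_vector.representation_ne_zero[of F x v] assms(2) r[of v] by auto
  have "x \<in> complex_vector.span (E \<union> F)"
    using x(1) complex_vector.span_mono[of E "E \<union> F"] by blast
  from complex_vector.sum_nonzero_representation_eq[OF assms(1) this]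
  show ?thesis by (simp add: 0)
qed

text \<open>
Let the null spaces of the powers stabilize at \<open>N = null_space (T ^^ p)\<close>. Then \<open>T x \<in> N\<close> iff \<open>x \<in> N\<close>,
hence \<open>N \<inter> range T = T ` N\<close> and \<open>N / T N\<close> embeds into the quotient by \<open>range T\<close>. By rank and nullity on the
finite-dimensional space \<open>N\<close>, the dimension of \<open>N / T N\<close> is the nullity of \<open>T\<close>.

In the proof \<open>A \<subseteq> Q\<close> are bases of the null space and of \<open>N\<close>, and \<open>F \<subseteq> P\<close> are bases of \<open>T N\<close> and
of \<open>N\<close>; the set \<open>E = P - F\<close> represents a basis of \<open>N / T N\<close>.
\<close>

lemma nullity_le_defect:
  assumes T: "bounded_clinear T" and "finite_dimensional (null_space T)"
    and p: "null_space (T ^^ p) = null_space (T ^^ Suc p)"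
  shows "nullity T \<le> defect T"
proof -
  interpret T: Vector_Spaces.linear scaleC scaleC T by (rule bounded_clinear_linear[OF T])
  let ?span = "complex_vector.span" let ?ind = "complex_vector.independent"
  define N where "N = null_space (T ^^ p)"
  have N: "finite_dimensional N"
    unfolding N_def by (rule finite_dimensional_null_space_funpow[OF assms(1,2)])
  have subN: "complex_vector.subspace N"
    unfolding N_def using subspace_null_space bounded_clinear_funpow[OF T] by blast
  have TN: "T x \<in> N \<longleftrightarrow> x \<in> N" for x
  proof -
    have "T x \<in> null_space (T ^^ p) \<longleftrightarrow> x \<in> null_space (T ^^ Suc p)"
      unfolding funpow_Suc_right by (simp add: null_space_def)
    then show ?thesis using p by (simp add: N_def)
  qed
  have 0: "0 \<in> N" using subN complex_vector.subspace_0 by blast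
  then have kerN: "null_space T \<subseteq> N" using TN by (force simp: null_space_def)
  obtain A where A: "A \<subseteq> null_space T" "finite A" "?ind A" "card A = complex_vector.dim (null_space T)"
    using finite_dimensional_basis[OF assms(2)] by metis
  obtain Q where Q: "A \<subseteq> Q" "Q \<subseteq> N" "?ind Q" "N \<subseteq> ?span Q"
    using complex_vector.maximal_independent_subset_extend[of A N] A kerN by blast
  obtain C where C: "finite C" "N \<subseteq> ?span C" using N by (auto simp: finite_dimensional_def)
  have finQ: "finite Q"
    using complex_vector.independent_span_bound[of C Q] C Q by blast
  have TQ: "T ` N \<subseteq> ?span (T ` (Q - A))"
  proof -
    have "T ` N \<subseteq> ?span (T ` Q)" using T.span_image[of Q] Q(4) by blast
    also have "?span (T ` Q) \<subseteq> ?span (T ` (Q - A))"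
    proof (rule complex_vector.span_minimal)
      show "T ` Q \<subseteq> ?span (T ` (Q - A))"
      proof
        fix y assume "y \<in> T ` Q"
        then obtain x where x: "x \<in> Q" "y = T x" by auto
        show "y \<in> ?span (T ` (Q - A))"
        proof (cases "x \<in> A")
          case True
          then have "y = 0" using A(1) x by (auto simp: null_space_def)
          then show ?thesis by (simp add: complex_vector.span_zero)
        next
          case False
          then show ?thesis using x by (intro complex_vector.span_base) auto
        qed
      qed
    qed (rule complex_vector.subspace_span)
    finally show ?thesis .
  qed
  obtain F where F: "F \<subseteq> T ` N" "?ind F" "T ` N \<subseteq> ?span F"
    using complex_vector.maximal_independent_subset[of "T ` N"] by blast
  have cardF: "finite F" "card F \<le> card (Q - A)"
  proof -
    have "F \<subseteq> ?span (T ` (Q - A))" using F(1) TQ by blast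
    with complex_vector.independent_span_bound[of "T ` (Q - A)" F] F(2) finQ
    have "finite F \<and> card F \<le> card (T ` (Q - A))" by blast
    then show "finite F" "card F \<le> card (Q - A)"
      using card_image_le[of "Q - A" T] finQ by auto
  qed
  have TNN: "T ` N \<subseteq> N" using TN by auto
  obtain P where P: "F \<subseteq> P" "P \<subseteq> N" "?ind P" "N \<subseteq> ?span P"
    using complex_vector.maximal_independent_subset_extend[of F N] F(1,2) TNN by blast
  have cardP: "card P = card Q"
    using complex_vector.basis_card_eq_dim[of P N] complex_vector.basis_card_eq_dim[of Q N] P Q
    by simp
  define E where "E = P - F"
  have "card A \<le> card E"
  proof -
    have "card (Q - A) = card Q - card A"
      using Q(1) A(2) by (intro card_Diff_subset)
    moreover have "card A \<le> card Q" by (rule card_mono[OF finQ Q(1)])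
    moreover have "card E = card P - card F"
      unfolding E_def using P(1) cardF(1) by (intro card_Diff_subset)
    ultimately show ?thesis using cardF(2) cardP by linarith
  qed
  have indE: "?ind E"
    by (rule complex_vector.independent_mono[OF P(3)]) (auto simp: E_def)
  have E0: "x = 0" if "x \<in> ?span E" "x \<in> range T" for x
  proof -
    have "?span E \<subseteq> N"
      using P(2) subN by (intro complex_vector.span_minimal) (auto simp: E_def)
    then have "x \<in> N" using that by blast
    then have "x \<in> ?span F" using that(2) TN F(3) by blast
    moreover have "?ind (E \<union> F)" "E \<inter> F = {}" using P(1,3) by (auto simp: E_def Un_absorb2)
    ultimately show ?thesis using independent_span_Int_span that(1) by blast
  qed
  have "card E \<le> card B" if B: "finite B" "?span (range T \<union> B) = UNIV" for B
  proof -
    have spanR: "?span (range T) = range T"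
      using T.subspace_image[of UNIV] complex_vector.span_eq_iff complex_vector.subspace_UNIV
      by blast
    \<comment> \<open>modulo the range each \<open>e\<close> equals some element of the span of \<open>B\<close>; extending this choice
      linearly from \<open>E\<close> gives an injective map of the span of \<open>E\<close> into the span of \<open>B\<close>\<close>
    have "\<exists>b\<in>?span B. e - b \<in> range T" for e
    proof -
      have "e \<in> ?span (range T \<union> B)" using B by simp
      then obtain r b where "e = r + b" "r \<in> range T" "b \<in> ?span B"
        unfolding complex_vector.span_Un spanR by auto
      then show ?thesis by (intro bexI[of _ b]) auto
    qed
    then obtain g where g: "\<And>e. g e \<in> ?span B" "\<And>e. e - g e \<in> range T" by metis
    interpret vp: vector_space_pair "scaleC :: complex \<Rightarrow> 'a \<Rightarrow> 'a" "scaleC :: complex \<Rightarrow> 'a \<Rightarrow> 'a" ..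
    obtain f where f: "Vector_Spaces.linear scaleC scaleC f" "\<forall>e\<in>E. f e = g e"
      using vp.linear_independent_extend[OF indE, of g] by blast
    interpret f: Vector_Spaces.linear scaleC scaleC f by (rule f)
    have fR: "x - f x \<in> range T" if "x \<in> ?span E" for x
      using that
    proof (rule complex_vector.span_induct_alt)
      show "0 - f 0 \<in> range T" by (auto intro: range_eqI[of _ _ 0])
    next
      fix c x y assume x: "x \<in> E" and y: "y - f y \<in> range T"
      have "scaleC c (x - g x) + (y - f y) \<in> range T"
        using g(2) y spanR
        by (metis complex_vector.span_add complex_vector.span_scale)
      also have "scaleC c (x - g x) + (y - f y) = scaleC c x + y - f (scaleC c x + y)"
        using f(2) x by (simp add: f.add f.scale complex_vector.scale_right_diff_distrib)
      finally show "scaleC c x + y - f (scaleC c x + y) \<in> range T" .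
    qed
    have inj: "inj_on f (?span E)"
      unfolding f.inj_on_iff_eq_0[OF complex_vector.subspace_span]
      using fR E0 by force
    then have "?ind (f ` E)" by (rule f.independent_injective_image[OF indE])
    moreover have "f ` E \<subseteq> ?span B" using f(2) g(1) by auto
    ultimately have "card (f ` E) \<le> card B"
      using complex_vector.independent_span_bound[OF B(1)] by blast
    moreover have "card (f ` E) = card E"
      using inj_on_subset[OF inj complex_vector.span_superset] by (rule card_image)
    ultimately show ?thesis by simp
  qed
  then have "enat (card E) \<le> defect T"
    unfolding defect_def ccodim_def by (intro Inf_greatest) auto
  moreover have "nullity T = enat (card A)"
    using assms(2) A(4) by (simp add: nullity_def cdim_def finite_dimensional_def)
  ultimately show ?thesis
    using \<open>card A \<le> card E\<close> by (metis enat_ord_simps(1) order_trans)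
qed

lemma fredholm_index_nonpos:
  assumes "nullity T \<le> defect T" "nullity T < \<infinity>"
  shows "fredholm_index T \<le> 0"
  using assms unfolding fredholm_index_def
  by (cases "nullity T"; cases "defect T") auto

section \<open>Closed ranges of powers\<close>

text \<open>
Bolzano--Weierstrass in a finite-dimensional subspace of a normed space. In the induction step the
old span is closed by the induction hypothesis, so the new vector \<open>b\<close> has a positive distance \<open>d\<close> from it,
and the \<open>b\<close>-coordinate of a vector \<open>x\<close> is at most \<open>\<parallel>x\<parallel> / d\<close>.
\<close>

lemma bounded_sequence_in_span_subsequence:
  fixes x :: "nat \<Rightarrow> 'a::complex_banach"
  assumes "finite B" "range x \<subseteq> complex_vector.span B" "bounded (range x)"
  shows "\<exists>l r. l \<in> complex_vector.span B \<and> strict_mono (r :: nat \<Rightarrow> nat) \<and> (x \<circ> r) \<longlonglongrightarrow> l"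
  using assms
proof (induction B arbitrary: x rule: finite_induct)
  case empty
  then have "x = (\<lambda>_. 0)" by auto
  then show ?case by (auto intro!: exI[of _ 0] exI[of _ id] strict_monoI)
next
  case (insert b B)
  let ?V = "complex_vector.span B"
  show ?case
  proof (cases "b \<in> ?V")
    case True
    then have "complex_vector.span (insert b B) = ?V" by (rule complex_vector.span_redundant)
    with insert show ?thesis by simp
  next
    case False
    have "closed ?V"
      unfolding closed_sequential_limits
    proof safe
      fix y l assume y: "\<forall>n. y n \<in> ?V" "y \<longlonglongrightarrow> l"
      have "bounded (range y)" using y(2) by (rule convergent_imp_bounded)
      with insert.IH[of y] y(1) obtain l' r where
        l': "l' \<in> ?V" "strict_mono (r :: nat \<Rightarrow> nat)" "(y \<circ> r) \<longlonglongrightarrow> l'" by blast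
      from y(2) l'(2) have "(y \<circ> r) \<longlonglongrightarrow> l" by (rule LIMSEQ_subseq_LIMSEQ)
      with l' show "l \<in> ?V" using LIMSEQ_unique by blast
    qed
    then have "open (- ?V)" by (simp add: open_Compl)
    with False obtain d where d: "d > 0" "ball b d \<subseteq> - ?V"
      using open_contains_ball by blast
    have "\<forall>n. \<exists>t. x n - scaleC t b \<in> ?V"
      using insert.prems(1) complex_vector.span_breakdown_eq[of _ b B] by blast
    then obtain t where t: "\<And>n. x n - scaleC (t n) b \<in> ?V" by metis
    obtain K where K: "\<And>n. norm (x n) \<le> K"
      using insert.prems(2) by (auto simp: bounded_iff)
    have "cmod (t n) * d \<le> K" for n
    proof (cases "t n = 0")
      case True
      then show ?thesis using K[of n] norm_ge_zero[of "x n"] by (simp del: norm_ge_zero)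
    next
      case False
      let ?v = "scaleC (- 1 / t n) (x n - scaleC (t n) b)"
      have v: "?v = b - scaleC (1 / t n) (x n)"
        using False by (simp add: complex_vector.scale_right_diff_distrib scaleC_scaleC)
      have "?v \<in> ?V" using t by (rule complex_vector.span_scale)
      then have "\<not> dist b ?v < d" using d(2) by auto
      moreover have "dist b ?v = norm (x n) / cmod (t n)"
        unfolding v by (simp add: dist_norm norm_scaleC norm_divide)
      ultimately have "d \<le> norm (x n) / cmod (t n)" by simp
      then have "cmod (t n) * d \<le> norm (x n)" using False by (simp add: field_simps)
      then show ?thesis using K[of n] by linarith
    qed
    then have "cmod (t n) \<le> K / d" for n using d by (simp add: field_simps)
    then have "bounded (range t)" by (auto simp: bounded_iff)
    then obtain c r where r: "strict_mono (r :: nat \<Rightarrow> nat)" "(t \<circ> r) \<longlonglongrightarrow> c"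
      using bounded_imp_convergent_subsequence by blast
    define v where "v = (\<lambda>n. x (r n) - scaleC (t (r n)) b)"
    have "norm (v n) \<le> K + K / d * norm b" for n
    proof -
      have "norm (v n) \<le> norm (x (r n)) + norm (scaleC (t (r n)) b)"
        unfolding v_def by (rule norm_triangle_ineq4)
      also have "\<dots> \<le> K + K / d * norm b"
        unfolding norm_scaleC using K \<open>\<And>n. cmod (t n) \<le> K / d\<close>
        by (intro add_mono mult_right_mono) auto
      finally show ?thesis .
    qed
    then have "bounded (range v)" by (auto simp: bounded_iff)
    moreover have "range v \<subseteq> ?V" using t by (auto simp: v_def)
    ultimately obtain l s where s: "l \<in> ?V" "strict_mono (s :: nat \<Rightarrow> nat)" "(v \<circ> s) \<longlonglongrightarrow> l"
      using insert.IH by blast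
    have "(t \<circ> r \<circ> s) \<longlonglongrightarrow> c" using r(2) s(2) by (rule LIMSEQ_subseq_LIMSEQ)
    then have "(\<lambda>n. (v \<circ> s) n + scaleC ((t \<circ> r \<circ> s) n) b) \<longlonglongrightarrow> l + scaleC c b"
      using s(3) by (intro tendsto_add scaleC_tendsto tendsto_const)
    then have "(x \<circ> (r \<circ> s)) \<longlonglongrightarrow> l + scaleC c b" by (simp add: v_def o_def)
    moreover have "l + scaleC c b \<in> complex_vector.span (insert b B)"
      unfolding complex_vector.span_breakdown_eq using s(1) by (intro exI[of _ c]) simp
    moreover have "strict_mono (r \<circ> s)" using r(1) s(2) by (rule strict_mono_o)
    ultimately show ?thesis by blast
  qed
qed

text \<open>
The open mapping theorem for \<open>T\<close> as a map onto its range, which is complete. By Baire's theorem the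
closure of the image of some ball has interior in the range, so each \<open>y\<close> in the range is approximated
up to \<open>\<parallel>y\<parallel> / 2\<close> by the image of some vector of norm at most \<open>K \<parallel>y\<parallel>\<close>; summing the successive corrections gives an
exact preimage.
\<close>

lemma closed_range_imp_bounded_preimages:
  fixes T :: "'a::banach \<Rightarrow> 'b::banach"
  assumes T: "bounded_linear T" and cl: "closed (range T)"
  shows "\<exists>C. \<forall>y\<in>range T. \<exists>x. T x = y \<and> norm x \<le> C * norm y"
proof -
  interpret T: bounded_linear T by fact
  define F where "F n = closure (T ` cball 0 (real n))" for n
  have FR: "F n \<subseteq> range T" for n
    unfolding F_def using cl by (intro closure_minimal) auto
  have "range T \<subseteq> (\<Union>n. F n)"
  proof
    fix y assume "y \<in> range T"
    then obtain x where x: "y = T x" by auto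
    obtain n where "norm x \<le> real n" using real_arch_simple by blast
    then have "y \<in> F n" unfolding F_def x by (intro subsetD[OF closure_subset]) auto
    then show "y \<in> (\<Union>n. F n)" by blast
  qed
  then have UF: "\<Union>(range F) = range T" using FR by blast
  let ?X = "top_of_set (range T)"
  have "completely_metrizable_space ?X"
    using completely_metrizable_space_closedin[OF completely_metrizable_space_euclidean]
      cl[unfolded closed_closedin] by blast
  moreover have "?X interior_of \<Union>(range F) \<noteq> {}"
    unfolding UF using interior_of_topspace[of ?X] by auto
  ultimately obtain n where "\<not> (closedin ?X (F n) \<and> ?X interior_of F n = {})"
    using Baire_category_alt[of ?X "range F"] by fastforce
  moreover have "closedin ?X (F n)"
    by (rule closed_subset[OF FR]) (simp add: F_def)
  ultimately obtain y0 where "y0 \<in> ?X interior_of F n" by blast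
  then obtain U where "openin ?X U" "y0 \<in> U" "U \<subseteq> F n"
    by (auto simp: interior_of_def)
  then obtain W where W: "open W" "y0 \<in> W" "range T \<inter> W \<subseteq> F n" and y0: "y0 \<in> range T"
    unfolding openin_open by blast
  obtain e where e: "e > 0" "ball y0 e \<subseteq> W" using W open_contains_ball by blast
  \<comment> \<open>differences of points of \<open>F n\<close> fill the ball of radius \<open>e\<close> around \<open>0\<close> in the range\<close>
  have small: "\<exists>x. norm x \<le> 2 * real n \<and> norm (y - T x) < \<delta>"
    if y: "y \<in> range T" "norm y < e" and \<delta>: "\<delta> > 0" for y \<delta>
  proof -
    have "y0 + y \<in> range T" using y(1) y0 by (auto simp flip: T.add)
    moreover have "y0 + y \<in> W" using y(2) e(2) by (force simp: dist_norm)
    ultimately have "y0 + y \<in> F n" using W(3) by blast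
    then obtain a where a: "norm a \<le> real n" "dist (T a) (y0 + y) < \<delta> / 2"
      unfolding F_def closure_approachable using half_gt_zero[OF \<delta>]
      by (metis (no_types, lifting) image_iff mem_cball_0)
    have "y0 \<in> F n" using W(2,3) y0 by blast
    then obtain b where b: "norm b \<le> real n" "dist (T b) y0 < \<delta> / 2"
      unfolding F_def closure_approachable using half_gt_zero[OF \<delta>]
      by (metis (no_types, lifting) image_iff mem_cball_0)
    have "y - T (a - b) = (y0 + y - T a) - (y0 - T b)" by (simp add: T.diff)
    then have "norm (y - T (a - b)) \<le> norm (y0 + y - T a) + norm (y0 - T b)"
      by (metis norm_triangle_ineq4)
    also have "\<dots> < \<delta>" using a(2) b(2) by (simp add: dist_norm norm_minus_commute)
    finally have "norm (y - T (a - b)) < \<delta>" .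
    moreover have "norm (a - b) \<le> 2 * real n"
      using norm_triangle_ineq4[of a b] a(1) b(1) by linarith
    ultimately show ?thesis by blast
  qed
  define K where "K = 4 * real n / e"
  have "\<exists>x. norm x \<le> K * norm y \<and> norm (y - T x) \<le> norm y / 2" if y: "y \<in> range T" for y
  proof (cases "y = 0")
    case True
    then show ?thesis by (intro exI[of _ 0]) (simp add: T.zero)
  next
    case False
    define s where "s = e / (2 * norm y)"
    have s: "s > 0" using False e by (simp add: s_def)
    have "s *\<^sub>R y \<in> range T" using y by (auto simp flip: T.scaleR)
    moreover have "norm (s *\<^sub>R y) < e" using False e by (simp add: s_def)
    moreover have "s * norm y / 2 > 0" using s False by simp
    ultimately obtain x where x: "norm x \<le> 2 * real n" "norm (s *\<^sub>R y - T x) < s * norm y / 2"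
      using small by blast
    have "norm (y - T (x /\<^sub>R s)) = norm (s *\<^sub>R y - T x) / s"
    proof -
      have "y - T (x /\<^sub>R s) = (s *\<^sub>R y - T x) /\<^sub>R s"
        using s by (simp add: T.scaleR scaleR_diff_right)
      then show ?thesis using s by (simp add: divide_inverse_commute)
    qed
    also have "\<dots> \<le> norm y / 2" using x(2) s by (simp add: field_simps)
    finally have "norm (y - T (x /\<^sub>R s)) \<le> norm y / 2" .
    moreover have "norm (x /\<^sub>R s) \<le> K * norm y"
    proof -
      have "norm (x /\<^sub>R s) = norm x / s" using s by (simp add: divide_inverse_commute)
      also have "\<dots> \<le> 2 * real n / s" using x(1) s by (simp add: divide_right_mono)
      also have "\<dots> = K * norm y" using False e by (simp add: s_def K_def field_simps)
      finally show ?thesis .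
    qed
    ultimately show ?thesis by blast
  qed
  then obtain g where g: "\<And>y. y \<in> range T \<Longrightarrow> norm (g y) \<le> K * norm y"
    "\<And>y. y \<in> range T \<Longrightarrow> norm (y - T (g y)) \<le> norm y / 2" by metis
  have K: "K \<ge> 0" using e by (simp add: K_def)
  have "\<exists>x. T x = y \<and> norm x \<le> (2 * K) * norm y" if y: "y \<in> range T" for y
  proof -
    \<comment> \<open>\<open>z k\<close> is the error left after \<open>k\<close> corrections\<close>
    define z where "z k = ((\<lambda>u. u - T (g u)) ^^ k) y" for k
    have z_Suc: "z (Suc k) = z k - T (g (z k))" for k by (simp add: z_def)
    have zR: "z k \<in> range T" for k
    proof (induction k)
      case 0
      then show ?case using y by (simp add: z_def)
    next
      case (Suc k)
      then show ?case unfolding z_Suc by (auto simp flip: T.diff)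
    qed
    have zn: "norm (z k) \<le> norm y * (1 / 2) ^ k" for k
    proof (induction k)
      case 0
      then show ?case by (simp add: z_def)
    next
      case (Suc k)
      then show ?case unfolding z_Suc using g(2)[OF zR[of k]] by simp
    qed
    have gz: "norm (g (z k)) \<le> K * norm y * (1 / 2) ^ k" for k
      using g(1)[OF zR[of k]] mult_left_mono[OF zn[of k] K] by (simp add: mult.assoc)
    have geo: "(\<lambda>k. K * norm y * (1 / 2) ^ k) sums (K * norm y * 2)"
      using sums_mult[OF geometric_sums[of "1 / 2 :: real"], of "K * norm y"] by simp
    have summ: "summable (\<lambda>k. g (z k))"
      by (rule summable_comparison_test'[OF sums_summable[OF geo], of 0])
        (simp only: gz real_norm_def abs_norm_cancel)
    have nsumm: "summable (\<lambda>k. norm (g (z k)))"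
      by (rule summable_comparison_test'[OF sums_summable[OF geo], of 0])
        (simp only: gz real_norm_def abs_norm_cancel)
    define x where "x = (\<Sum>k. g (z k))"
    have "(\<lambda>k. T (g (z k))) sums T x"
      unfolding x_def by (intro T.sums summable_sums summ)
    moreover have "(\<lambda>k. T (g (z k))) sums y"
    proof -
      have "(\<lambda>k. norm y * (1 / 2) ^ k) \<longlonglongrightarrow> norm y * 0"
        by (intro tendsto_mult tendsto_const LIMSEQ_power_zero) simp
      then have "z \<longlonglongrightarrow> 0"
        using zn by (intro Lim_null_comparison[of z "\<lambda>k. norm y * (1 / 2) ^ k"]) auto
      from telescope_sums'[OF this] have "(\<lambda>k. z k - z (Suc k)) sums (z 0 - 0)" .
      then show ?thesis by (simp add: z_Suc) (simp add: z_def)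
    qed
    ultimately have "T x = y" by (rule sums_unique2)
    moreover have "norm x \<le> (\<Sum>k. norm (g (z k)))"
      unfolding x_def by (rule summable_norm[OF nsumm])
    moreover have "(\<Sum>k. norm (g (z k))) \<le> K * norm y * 2"
      using suminf_le[OF gz nsumm sums_summable[OF geo]] sums_unique[OF geo] by simp
    ultimately show ?thesis by (intro exI[of _ x]) (simp add: mult_ac)
  qed
  then show ?thesis by blast
qed

text \<open>
For bounded operators on a Banach space this compactness property is equivalent to having a closed range
and a finite-dimensional null space. Unlike closedness of the range alone, it passes to powers and
back by composing convergent sequences.
\<close>

definition proper_on_bounded :: "('a::real_normed_vector \<Rightarrow> 'b::real_normed_vector) \<Rightarrow> bool" where
  "proper_on_bounded T \<longleftrightarrow> (\<forall>x y. bounded (range x) \<and> (\<lambda>n. T (x n)) \<longlonglongrightarrow> y \<longrightarrow>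
     (\<exists>l r. strict_mono (r :: nat \<Rightarrow> nat) \<and> (x \<circ> r) \<longlonglongrightarrow> l))"

lemma proper_on_boundedD:
  assumes "proper_on_bounded T" "bounded (range x)" "(\<lambda>n. T (x n)) \<longlonglongrightarrow> y"
  obtains l r where "strict_mono (r :: nat \<Rightarrow> nat)" "(x \<circ> r) \<longlonglongrightarrow> l"
  using assms unfolding proper_on_bounded_def by blast

text \<open>
If \<open>T (x n)\<close> tends to \<open>T w\<close>, bounded preimages \<open>u n\<close> of \<open>T (x n - w)\<close> tend to zero, and
\<open>x n - w - u n\<close> is a bounded sequence in the finite-dimensional null space.
\<close>

lemma proper_on_bounded_if_closed_range:
  fixes T :: "'a::complex_banach \<Rightarrow> 'a"
  assumes T: "bounded_clinear T" and cl: "closed (range T)"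
    and N: "finite_dimensional (null_space T)"
  shows "proper_on_bounded T"
  unfolding proper_on_bounded_def
proof (intro allI impI, elim conjE)
  fix x :: "nat \<Rightarrow> 'a" and y assume x: "bounded (range x)" and y: "(\<lambda>n. T (x n)) \<longlonglongrightarrow> y"
  interpret T: bounded_linear T using T by (rule bounded_clinear_bounded_linear)
  obtain C where C: "\<forall>y\<in>range T. \<exists>x. T x = y \<and> norm x \<le> C * norm y"
    using closed_range_imp_bounded_preimages[OF T.bounded_linear_axioms cl] by blast
  obtain B where B: "finite B" "null_space T \<subseteq> complex_vector.span B"
    using N by (auto simp: finite_dimensional_def)
  have "y \<in> range T" using closed_sequentially[OF cl _ y] by simp
  then obtain w where w: "y = T w" by auto
  have "\<forall>n. \<exists>u. T u = T (x n - w) \<and> norm u \<le> C * norm (T (x n - w))" using C by blast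
  then obtain u where u: "\<And>n. T (u n) = T (x n - w)" "\<And>n. norm (u n) \<le> C * norm (T (x n - w))"
    by metis
  have "(\<lambda>n. C * norm (T (x n) - y)) \<longlonglongrightarrow> C * norm (y - y)"
    by (intro tendsto_intros y)
  then have "(\<lambda>n. C * norm (T (x n) - y)) \<longlonglongrightarrow> 0" by simp
  then have u0: "u \<longlonglongrightarrow> 0"
    using u(2) by (intro Lim_null_comparison[of u "\<lambda>n. C * norm (T (x n) - y)"])
      (auto simp: w T.diff)
  define v where "v n = x n - w - u n" for n
  have "bounded (range v)"
  proof -
    obtain K where "\<And>n. norm (x n) \<le> K" using x by (auto simp: bounded_iff)
    moreover obtain L where "\<And>n. norm (u n) \<le> L"
      using convergent_imp_bounded[OF u0] by (auto simp: bounded_iff)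
    ultimately have "norm (v n) \<le> K + norm w + L" for n
      unfolding v_def by (meson add_mono order_refl norm_triangle_le_diff order_trans norm_triangle_ineq4)
    then show ?thesis by (auto simp: bounded_iff)
  qed
  moreover have "range v \<subseteq> complex_vector.span B"
    using B(2) u(1) by (auto simp: v_def null_space_def T.diff)
  ultimately obtain l r where r: "strict_mono (r :: nat \<Rightarrow> nat)" "(v \<circ> r) \<longlonglongrightarrow> l"
    using bounded_sequence_in_span_subsequence[OF B(1), of v] by blast
  have "(u \<circ> r) \<longlonglongrightarrow> 0" using u0 r(1) by (rule LIMSEQ_subseq_LIMSEQ)
  then have "(\<lambda>n. (v \<circ> r) n + w + (u \<circ> r) n) \<longlonglongrightarrow> l + w + 0"
    using r(2) by (intro tendsto_intros)
  then have "(x \<circ> r) \<longlonglongrightarrow> l + w" by (simp add: v_def o_def)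
  with r(1) show "\<exists>l r. strict_mono r \<and> (x \<circ> r) \<longlonglongrightarrow> l" by blast
qed

text \<open>
A substitute for passing to the quotient by the null space: the norm of \<open>u\<close> is comparable with the
quotient norm of \<open>x\<close>. The cases are separated because for \<open>T x \<noteq> 0\<close> the infimum of the norms of
preimages is positive, so that twice the infimum exceeds it.
\<close>

lemma almost_minimal_preimage:
  assumes T: "bounded_linear T"
  shows "\<exists>u. T u = T x \<and> (\<forall>v. T v = T x \<longrightarrow> norm u \<le> 2 * norm v)"
proof (cases "T x = 0")
  case True
  then show ?thesis
    by (intro exI[of _ 0]) (simp add: linear_0 bounded_linear.linear[OF T])
next
  case False
  let ?S = "norm ` {v. T v = T x}"
  obtain K where K: "K > 0" "\<And>v. norm (T v) \<le> norm v * K"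
    using bounded_linear.pos_bounded[OF T] by blast
  have "norm (T x) / K \<le> Inf ?S"
  proof (intro cInf_greatest)
    fix s assume "s \<in> ?S"
    then obtain v where "T v = T x" "s = norm v" by auto
    then show "norm (T x) / K \<le> s" using K(2)[of v] K(1) by (simp add: field_simps)
  qed auto
  moreover have "norm (T x) / K > 0" using False K by simp
  ultimately have "Inf ?S < 2 * Inf ?S" by linarith
  moreover have ne: "?S \<noteq> {}" by auto
  moreover have bdd: "bdd_below ?S" by (auto intro!: bdd_belowI[of _ 0])
  ultimately obtain s where "s \<in> ?S" "s < 2 * Inf ?S"
    using cInf_less_iff[of ?S "2 * Inf ?S"] by blast
  then obtain u where u: "T u = T x" "norm u < 2 * Inf ?S" by auto
  have "norm u \<le> 2 * norm v" if "T v = T x" for v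
    using cInf_lower[OF _ bdd, of "norm v"] that u(2) by fastforce
  with u(1) show ?thesis by blast
qed

text \<open>
Almost minimal preimages satisfy \<open>\<parallel>u\<parallel> \<le> C \<parallel>T u\<parallel>\<close>. Otherwise normalized counterexamples would have a limit \<open>l\<close>
in the null space, and subtracting a multiple of \<open>l\<close> from such a \<open>u\<close> would give a much shorter preimage of
\<open>T u\<close>. Hence almost minimal preimages of a convergent sequence are bounded.
\<close>

lemma closed_range_if_proper_on_bounded:
  fixes T :: "'a::banach \<Rightarrow> 'b::real_normed_vector"
  assumes T: "bounded_linear T" and proper: "proper_on_bounded T"
  shows "closed (range T)"
proof -
  interpret T: bounded_linear T by fact
  define almost_min where "almost_min u \<longleftrightarrow> (\<forall>v. T v = T u \<longrightarrow> norm u \<le> 2 * norm v)" for u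
  have "\<exists>C. \<forall>u. almost_min u \<longrightarrow> norm u \<le> C * norm (T u)"
  proof (rule ccontr)
    assume "\<not> ?thesis"
    then have "\<forall>n::nat. \<exists>u. almost_min u \<and> norm u > real n * norm (T u)"
      by (meson not_less)
    then obtain u where u: "\<And>n. almost_min (u n)" "\<And>n. norm (u n) > real n * norm (T (u n))"
      by metis
    have pos: "norm (u n) > 0" for n
      using u(2)[of n] by (meson le_less_trans mult_nonneg_nonneg norm_ge_zero of_nat_0_le_iff)
    define w where "w n = u n /\<^sub>R norm (u n)" for n
    have w1: "norm (w n) = 1" for n using pos[of n] by (simp add: w_def)
    have "norm (T (w n)) \<le> 1 / real n" if "n > 0" for n
    proof -
      have "norm (T (w n)) = norm (T (u n)) / norm (u n)"
        by (simp add: w_def T.scaleR divide_inverse_commute)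
      also have "\<dots> \<le> 1 / real n" using u(2)[of n] pos[of n] that by (simp add: field_simps)
      finally show ?thesis .
    qed
    then have "eventually (\<lambda>n. norm (T (w n)) \<le> 1 / real n) sequentially"
      unfolding eventually_sequentially by (intro exI[of _ 1]) auto
    then have Tw: "(\<lambda>n. T (w n)) \<longlonglongrightarrow> 0"
      using lim_1_over_n by (rule Lim_null_comparison)
    have "bounded (range w)" using w1 by (auto simp: bounded_iff intro!: exI[of _ 1])
    then obtain l r where r: "strict_mono (r :: nat \<Rightarrow> nat)" "(w \<circ> r) \<longlonglongrightarrow> l"
      using proper_on_boundedD[OF proper _ Tw] by blast
    have "(\<lambda>n. T ((w \<circ> r) n)) \<longlonglongrightarrow> T l" using r(2) by (rule T.tendsto)
    moreover have "(\<lambda>n. T ((w \<circ> r) n)) \<longlonglongrightarrow> 0"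
      using LIMSEQ_subseq_LIMSEQ[OF Tw r(1)] by (simp add: o_def)
    ultimately have Tl: "T l = 0" by (rule LIMSEQ_unique)
    obtain n where "dist ((w \<circ> r) n) l < 1 / 2"
      using tendstoD[OF r(2), of "1/2"] by (auto simp: eventually_sequentially)
    then have n: "norm (w (r n) - l) < 1 / 2" by (simp add: dist_norm)
    define c where "c = norm (u (r n))"
    have c: "c > 0" using pos by (simp add: c_def)
    have "T (u (r n) - c *\<^sub>R l) = T (u (r n))" by (simp add: T.diff T.scaleR Tl)
    then have "norm (u (r n)) \<le> 2 * norm (u (r n) - c *\<^sub>R l)"
      using u(1) unfolding almost_min_def by blast
    moreover have "u (r n) - c *\<^sub>R l = c *\<^sub>R (w (r n) - l)"
      using c by (simp add: w_def c_def scaleR_diff_right)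
    ultimately have "c \<le> 2 * (c * norm (w (r n) - l))" using c by (simp add: c_def)
    then show False using n c by (simp add: field_simps)
  qed
  then obtain C where C: "\<And>u. almost_min u \<Longrightarrow> norm u \<le> C * norm (T u)" by blast
  show ?thesis
    unfolding closed_sequential_limits
  proof safe
    fix y l assume y: "\<forall>n. y n \<in> range T" "y \<longlonglongrightarrow> l"
    have "\<exists>u. almost_min u \<and> T u = y n" for n
    proof -
      obtain x where "y n = T x" using y(1) by blast
      then show ?thesis using almost_minimal_preimage[OF T, of x] unfolding almost_min_def by metis
    qed
    then obtain u where u: "\<And>n. almost_min (u n)" "\<And>n. T (u n) = y n" by metis
    obtain K where K: "\<And>n. norm (y n) \<le> K"
      using convergent_imp_bounded[OF y(2)] by (auto simp: bounded_iff)
    have "norm (u n) \<le> \<bar>C\<bar> * K" for n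
    proof -
      have "norm (u n) \<le> C * norm (y n)" using C[OF u(1)[of n]] u(2) by simp
      also have "\<dots> \<le> \<bar>C\<bar> * K" using K by (intro mult_mono) auto
      finally show ?thesis .
    qed
    then have "bounded (range u)" by (auto simp: bounded_iff)
    moreover have "(\<lambda>n. T (u n)) \<longlonglongrightarrow> l" using y(2) u(2) by simp
    ultimately obtain x r where r: "strict_mono (r :: nat \<Rightarrow> nat)" "(u \<circ> r) \<longlonglongrightarrow> x"
      using proper_on_boundedD[OF proper] by blast
    have "(\<lambda>n. T ((u \<circ> r) n)) \<longlonglongrightarrow> T x" using r(2) by (rule T.tendsto)
    moreover have "(\<lambda>n. T ((u \<circ> r) n)) \<longlonglongrightarrow> l"
      using LIMSEQ_subseq_LIMSEQ[OF y(2) r(1)] u(2) by (simp add: o_def)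
    ultimately have "T x = l" by (rule LIMSEQ_unique)
    then show "l \<in> range T" by blast
  qed
qed

lemma proper_on_bounded_funpow:
  fixes T :: "'a::real_normed_vector \<Rightarrow> 'a"
  assumes T: "bounded_linear T" and proper: "proper_on_bounded T"
  shows "proper_on_bounded (T ^^ n)"
proof (induction n)
  case 0
  show ?case
    unfolding proper_on_bounded_def by (auto intro!: exI[of _ id] strict_monoI)
next
  case (Suc n)
  interpret T: bounded_linear T by fact
  show ?case
    unfolding proper_on_bounded_def
  proof (intro allI impI, elim conjE)
    fix x :: "nat \<Rightarrow> 'a" and y assume x: "bounded (range x)" and y: "(\<lambda>k. (T ^^ Suc n) (x k)) \<longlonglongrightarrow> y"
    have "bounded (T ` range x)" using x T by (rule bounded_linear_image)
    then have "bounded (range (\<lambda>k. T (x k)))" by (simp add: image_image)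
    moreover have "(\<lambda>k. (T ^^ n) (T (x k))) \<longlonglongrightarrow> y"
      using y by (simp add: funpow_swap1)
    ultimately obtain l r where r: "strict_mono (r :: nat \<Rightarrow> nat)" "((\<lambda>k. T (x k)) \<circ> r) \<longlonglongrightarrow> l"
      using proper_on_boundedD[OF Suc] by blast
    have "bounded (range (x \<circ> r))" using x by (rule bounded_subset) auto
    moreover have "(\<lambda>k. T ((x \<circ> r) k)) \<longlonglongrightarrow> l" using r(2) by (simp add: o_def)
    ultimately obtain l' s where s: "strict_mono (s :: nat \<Rightarrow> nat)" "((x \<circ> r) \<circ> s) \<longlonglongrightarrow> l'"
      using proper_on_boundedD[OF proper] by blast
    have "strict_mono (r \<circ> s)" using r(1) s(1) by (rule strict_mono_o)
    moreover have "(x \<circ> (r \<circ> s)) \<longlonglongrightarrow> l'" using s(2) by (simp add: o_assoc)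
    ultimately show "\<exists>l r. strict_mono r \<and> (x \<circ> r) \<longlonglongrightarrow> l" by blast
  qed
qed

lemma proper_on_bounded_if_funpow:
  fixes T :: "'a::complex_banach \<Rightarrow> 'a"
  assumes T: "bounded_clinear T" and proper: "proper_on_bounded (T ^^ Suc n)"
  shows "proper_on_bounded T"
  unfolding proper_on_bounded_def
proof (intro allI impI, elim conjE)
  fix x :: "nat \<Rightarrow> 'a" and y assume x: "bounded (range x)" and y: "(\<lambda>k. T (x k)) \<longlonglongrightarrow> y"
  have "(\<lambda>k. (T ^^ n) (T (x k))) \<longlonglongrightarrow> (T ^^ n) y"
    using bounded_clinear_bounded_linear[OF bounded_clinear_funpow[OF T]] y
    by (rule bounded_linear.tendsto)
  then have "(\<lambda>k. (T ^^ Suc n) (x k)) \<longlonglongrightarrow> (T ^^ n) y" by (simp add: funpow_swap1)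
  with proper x show "\<exists>l r. strict_mono r \<and> (x \<circ> r) \<longlonglongrightarrow> l"
    unfolding proper_on_bounded_def by blast
qed

lemma closed_range_funpow_iff:
  fixes T :: "'a::complex_banach \<Rightarrow> 'a"
  assumes T: "bounded_clinear T" and N: "finite_dimensional (null_space T)"
  shows "closed (range (T ^^ Suc n)) \<longleftrightarrow> closed (range T)"
proof
  assume "closed (range (T ^^ Suc n))"
  then have "proper_on_bounded (T ^^ Suc n)"
    by (rule proper_on_bounded_if_closed_range[OF bounded_clinear_funpow[OF T] _
        finite_dimensional_null_space_funpow[OF T N]])
  then have "proper_on_bounded T" by (rule proper_on_bounded_if_funpow[OF T])
  then show "closed (range T)"
    by (rule closed_range_if_proper_on_bounded[OF bounded_clinear_bounded_linear[OF T]])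
next
  assume "closed (range T)"
  then have "proper_on_bounded T" by (rule proper_on_bounded_if_closed_range[OF T _ N])
  then have "proper_on_bounded (T ^^ Suc n)"
    by (rule proper_on_bounded_funpow[OF bounded_clinear_bounded_linear[OF T]])
  then show "closed (range (T ^^ Suc n))"
    by (rule closed_range_if_proper_on_bounded[OF
        bounded_clinear_bounded_linear[OF bounded_clinear_funpow[OF T]]])
qed

section \<open>Spectra of (H)-operators\<close>

lemma not_approx_point_spectrum_iff:
  assumes T: "bounded_clinear T"
  shows "\<mu> \<notin> approx_point_spectrum T \<longleftrightarrow> (\<exists>c>0. \<forall>x. c * norm x \<le> norm (shift_op T \<mu> x))"
proof -
  let ?A = "shift_op T \<mu>"
  interpret A: bounded_linear ?A
    using bounded_clinear_bounded_linear[OF bounded_clinear_shift_op[OF T]] .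
  have "\<mu> \<in> approx_point_spectrum T" if no: "\<not> (\<exists>c>0. \<forall>x. c * norm x \<le> norm (?A x))"
  proof -
    have "\<forall>n::nat. \<exists>x. norm (?A x) < 1 / real (Suc n) * norm x"
    proof
      fix n :: nat
      have "1 / real (Suc n) > 0" by simp
      then show "\<exists>x. norm (?A x) < 1 / real (Suc n) * norm x" using no not_less by blast
    qed
    then obtain x where x: "\<And>n::nat. norm (?A (x n)) < 1 / real (Suc n) * norm (x n)" by metis
    have pos: "norm (x n) > 0" for n
    proof (rule ccontr)
      assume "\<not> norm (x n) > 0"
      then have "x n = 0" by simp
      then show False using x[of n] by (simp add: A.zero)
    qed
    define u where "u n = x n /\<^sub>R norm (x n)" for n
    have "norm (?A (u n)) \<le> 1 / real (Suc n)" for n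
    proof -
      have "norm (?A (u n)) = norm (?A (x n)) / norm (x n)"
        by (simp add: u_def A.scaleR divide_inverse_commute)
      also have "\<dots> \<le> 1 / real (Suc n)"
        using x[of n] pos[of n] by (simp add: divide_le_eq)
      finally show ?thesis .
    qed
    then have "(\<lambda>n. ?A (u n)) \<longlonglongrightarrow> 0"
      by (intro Lim_null_comparison[OF always_eventually LIMSEQ_inverse_real_of_nat])
        (auto simp: inverse_eq_divide)
    moreover have "norm (u n) = 1" for n using pos[of n] by (simp add: u_def)
    ultimately show ?thesis by (auto simp: approx_point_spectrum_def)
  qed
  moreover have False if c: "c > 0" "\<forall>x. c * norm x \<le> norm (?A x)"
    and mu: "\<mu> \<in> approx_point_spectrum T" for c
  proof -
    obtain x :: "nat \<Rightarrow> 'a" where x: "\<forall>n. norm (x n) = 1" "(\<lambda>n. ?A (x n)) \<longlonglongrightarrow> 0"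
      using mu by (auto simp: approx_point_spectrum_def)
    obtain n where "norm (?A (x n)) < c"
      using tendstoD[OF x(2) c(1)] by (auto simp: eventually_sequentially)
    then show False using c(2) x(1) by (metis mult.right_neutral not_less)
  qed
  ultimately show ?thesis by blast
qed

lemma closed_approx_point_spectrum:
  assumes T: "bounded_clinear T"
  shows "closed (approx_point_spectrum T)"
proof -
  have "\<exists>e>0. ball \<mu> e \<subseteq> - approx_point_spectrum T" if "\<mu> \<in> - approx_point_spectrum T" for \<mu>
  proof -
    obtain c where c: "c > 0" "\<And>x. c * norm x \<le> norm (shift_op T \<mu> x)"
      using \<open>\<mu> \<in> _\<close> not_approx_point_spectrum_iff[OF T, of \<mu>] by auto
    have "\<nu> \<notin> approx_point_spectrum T" if nu: "cmod (\<mu> - \<nu>) < c / 2" for \<nu>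
    proof -
      have "c / 2 * norm x \<le> norm (shift_op T \<nu> x)" for x
      proof -
        have "shift_op T \<mu> x = shift_op T \<nu> x - scaleC (\<mu> - \<nu>) x"
          by (simp add: shift_op_def complex_vector.scale_left_diff_distrib)
        then have "norm (shift_op T \<mu> x) \<le> norm (shift_op T \<nu> x) + cmod (\<mu> - \<nu>) * norm x"
          by (metis norm_scaleC norm_triangle_ineq4)
        moreover have "cmod (\<mu> - \<nu>) * norm x \<le> c / 2 * norm x"
          using nu by (intro mult_right_mono) auto
        ultimately show ?thesis using c(2)[of x] by (simp add: field_simps)
      qed
      moreover have "c / 2 > 0" using c by simp
      ultimately show ?thesis unfolding not_approx_point_spectrum_iff[OF T] by blast
    qed
    then show ?thesis using c(1) by (intro exI[of _ "c / 2"]) (auto simp: dist_norm)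
  qed
  then show ?thesis unfolding closed_def open_contains_ball by blast
qed

lemma approx_point_spectrum_subset_spectrum:
  assumes T: "bounded_clinear T"
  shows "approx_point_spectrum T \<subseteq> spectrum T"
proof (rule ccontr)
  assume "\<not> ?thesis"
  then obtain \<mu> where mu: "\<mu> \<in> approx_point_spectrum T" "\<mu> \<notin> spectrum T" by blast
  then obtain R where R: "bounded_clinear R" "R \<circ> shift_op T \<mu> = id"
    by (auto simp: spectrum_def)
  obtain K where K: "K > 0" "\<And>x. norm (R x) \<le> norm x * K"
    using bounded_linear.pos_bounded[OF bounded_clinear_bounded_linear[OF R(1)]] by blast
  have "1 / K * norm x \<le> norm (shift_op T \<mu> x)" for x
    using K(2)[of "shift_op T \<mu> x"] K(1) fun_cong[OF R(2), of x] by (simp add: field_simps)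
  moreover have "1 / K > 0" using K by simp
  ultimately show False using mu(1) not_approx_point_spectrum_iff[OF T] by blast
qed

lemma nullity_less_infinity_iff: "nullity T < \<infinity> \<longleftrightarrow> finite_dimensional (null_space T)"
  unfolding nullity_def by (rule cdim_less_infinity_iff)

lemma upper_semi_Fredholm_iff:
  "upper_semi_Fredholm T \<longleftrightarrow> closed (range T) \<and> finite_dimensional (null_space T)"
  unfolding upper_semi_Fredholm_def nullity_less_infinity_iff ..

lemma nullity_eq_0_iff:
  assumes "bounded_clinear T"
  shows "nullity T = 0 \<longleftrightarrow> null_space T = {0}"
  using complex_vector.subspace_0[OF subspace_null_space[OF assms]]
  by (auto simp: nullity_def cdim_eq_0_iff)

lemma upper_semi_Fredholm_if_bounded_below:
  assumes T: "bounded_clinear T" and c: "c > 0" "\<And>x. c * norm x \<le> norm (T x)"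
  shows "upper_semi_Fredholm T" "null_space T = {0}"
proof -
  have "complete (range T)"
    using c bounded_clinear_bounded_linear[OF T] complete_UNIV
    by (intro complete_isometric_image[of c]) auto
  then have "closed (range T)" by (rule complete_imp_closed)
  moreover show N: "null_space T = {0}"
    using c(2) c(1) linear_0[OF bounded_linear.linear[OF bounded_clinear_bounded_linear[OF T]]]
    by (auto simp: null_space_def) (metis mult_le_0_iff norm_le_zero_iff norm_zero not_less)
  ultimately show "upper_semi_Fredholm T"
    by (auto simp: upper_semi_Fredholm_iff finite_dimensional_def)
qed

lemma null_space_funpow_mono:
  assumes "bounded_clinear T" "m \<le> n"
  shows "null_space (T ^^ m) \<subseteq> null_space (T ^^ n)"
proof -
  have 0: "(T ^^ k) 0 = 0" for k
    using bounded_clinear_bounded_linear[OF bounded_clinear_funpow[OF assms(1)]]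
    by (simp add: linear_0 bounded_linear.linear)
  have "T ^^ n = T ^^ (n - m) \<circ> T ^^ m" using assms(2) by (simp flip: funpow_add)
  then show ?thesis by (auto simp: null_space_def 0)
qed

lemma null_space_funpow_subset_quasinilpotent_part:
  assumes "bounded_clinear T"
  shows "null_space (T ^^ n) \<subseteq> quasinilpotent_part T"
proof
  fix x assume "x \<in> null_space (T ^^ n)"
  then have "(T ^^ k) x = 0" if "k \<ge> n" for k
    using null_space_funpow_mono[OF assms that] by (auto simp: null_space_def)
  then have "eventually (\<lambda>k. root k (norm ((T ^^ k) x)) = 0) sequentially"
    unfolding eventually_sequentially by (intro exI[of _ n]) simp
  then show "x \<in> quasinilpotent_part T"
    unfolding quasinilpotent_part_def by (simp add: tendsto_eventually)
qed

text \<open>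
All null spaces of powers lie in the quasinilpotent part, which for an \<open>(H)\<close>-operator is one of them.
\<close>

lemma H_operator_null_space_stabilizes:
  assumes T: "bounded_clinear T" and H: "H_operator T"
  shows "\<exists>p. null_space (shift_op T \<mu> ^^ p) = null_space (shift_op T \<mu> ^^ Suc p)"
proof -
  have A: "bounded_clinear (shift_op T \<mu>)" by (rule bounded_clinear_shift_op[OF T])
  obtain p where "quasinilpotent_part (shift_op T \<mu>) = null_space (shift_op T \<mu> ^^ p)"
    using H unfolding H_operator_def by blast
  then have "null_space (shift_op T \<mu> ^^ Suc p) \<subseteq> null_space (shift_op T \<mu> ^^ p)"
    using null_space_funpow_subset_quasinilpotent_part[OF A] by blast
  moreover have "null_space (shift_op T \<mu> ^^ p) \<subseteq> null_space (shift_op T \<mu> ^^ Suc p)"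
    by (rule null_space_funpow_mono[OF A]) simp
  ultimately show ?thesis by blast
qed

text \<open>
Finite ascent makes the index nonpositive, so the index condition in the definition of upper
semi-Weyl operators is automatic.
\<close>

lemma H_operator_upper_semi_Weyl_iff:
  assumes T: "bounded_clinear T" and H: "H_operator T"
  shows "upper_semi_Weyl (shift_op T \<mu>) \<longleftrightarrow> upper_semi_Fredholm (shift_op T \<mu>)"
proof -
  have A: "bounded_clinear (shift_op T \<mu>)" by (rule bounded_clinear_shift_op[OF T])
  obtain p where p: "null_space (shift_op T \<mu> ^^ p) = null_space (shift_op T \<mu> ^^ Suc p)"
    using H_operator_null_space_stabilizes[OF T H] by blast
  show ?thesis
    using nullity_le_defect[OF A _ p] fredholm_index_nonpos[of "shift_op T \<mu>"]
    unfolding upper_semi_Weyl_def upper_semi_Fredholm_iff nullity_less_infinity_iff by blast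
qed

text \<open>
The ascent is always finite here, so a left pole of finite rank differs from a point of the approximate
point spectrum with upper semi-Fredholm shift only in that the closed range is required of a power.
\<close>

lemma H_operator_left_poles_finite_rank:
  assumes T: "bounded_clinear T" and H: "H_operator T"
  shows "left_poles_finite_rank T = approx_point_spectrum T - upper_semi_Weyl_spectrum T"
proof (rule set_eqI)
  fix \<mu>
  let ?A = "shift_op T \<mu>"
  have A: "bounded_clinear ?A" by (rule bounded_clinear_shift_op[OF T])
  obtain q where q: "null_space (?A ^^ q) = null_space (?A ^^ Suc q)"
    using H_operator_null_space_stabilizes[OF T H] by blast
  have "ascent ?A \<le> enat q"
    unfolding ascent_def using q by (intro Inf_lower) auto
  then obtain p where p: "ascent ?A = enat p" by (cases "ascent ?A") auto
  have "\<mu> \<in> left_poles_finite_rank T \<longleftrightarrow> \<mu> \<in> approx_point_spectrum T \<and>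
      closed (range (?A ^^ Suc p)) \<and> finite_dimensional (null_space ?A)"
    unfolding left_poles_finite_rank_def left_pole_def p nullity_less_infinity_iff
    by (simp add: p del: funpow.simps)
  also have "\<dots> \<longleftrightarrow> \<mu> \<in> approx_point_spectrum T \<and> upper_semi_Fredholm ?A"
    using closed_range_funpow_iff[OF A] by (auto simp only: upper_semi_Fredholm_iff)
  finally show "\<mu> \<in> left_poles_finite_rank T \<longleftrightarrow>
      \<mu> \<in> approx_point_spectrum T - upper_semi_Weyl_spectrum T"
    by (simp add: upper_semi_Weyl_spectrum_def H_operator_upper_semi_Weyl_iff[OF T H])
qed

lemma H_operator_upper_semi_Weyl_if_not_approx:
  assumes T: "bounded_clinear T" and H: "H_operator T" and "\<mu> \<notin> approx_point_spectrum T"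
  shows "\<mu> \<notin> upper_semi_Weyl_spectrum T"
  using assms(3) upper_semi_Fredholm_if_bounded_below(1)[OF bounded_clinear_shift_op[OF T, of \<mu>]]
  unfolding not_approx_point_spectrum_iff[OF T] upper_semi_Weyl_spectrum_def
  by (auto simp: H_operator_upper_semi_Weyl_iff[OF T H])

text \<open>
Off the approximate point spectrum an \<open>(H)\<close>-operator has an upper semi-Weyl shift, while on it the left poles of
finite rank are exactly the points with upper semi-Weyl shift. Property \<open>(az)\<close> can therefore fail only
through points of the spectrum outside the approximate point spectrum.
\<close>

lemma property_az_iff:
  assumes T: "bounded_clinear T" and H: "H_operator T"
  shows "property_az T \<longleftrightarrow> spectrum T = approx_point_spectrum T"
  unfolding property_az_def H_operator_left_poles_finite_rank[OF T H]
  using approx_point_spectrum_subset_spectrum[OF T] H_operator_upper_semi_Weyl_if_not_approx[OF T H]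
  by blast

lemma property_z_imp_spectrum_eq:
  assumes T: "bounded_clinear T" and H: "H_operator T" and z: "property_z T"
  shows "spectrum T = approx_point_spectrum T"
proof -
  have "isolated_finite_mult_eigenvalues T \<subseteq> approx_point_spectrum T"
    by (auto simp: isolated_finite_mult_eigenvalues_def iso_def isolated_in_def)
  then show ?thesis
    using z approx_point_spectrum_subset_spectrum[OF T]
      H_operator_upper_semi_Weyl_if_not_approx[OF T H]
    unfolding property_z_def by blast
qed

text \<open>
If \<open>T - \<mu>\<close> is injective, so are its powers, and the quasinilpotent part, being the null space of a power,
is zero; at an isolated point of the spectrum this forces \<open>T - \<mu>\<close> to be bounded below.
\<close>

lemma H_operator_isoloid:
  assumes T: "bounded_clinear T" and H: "H_operator T" and iso: "\<mu> \<in> iso (spectrum T)"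
    and N: "null_space (shift_op T \<mu>) = {0}"
  shows "\<mu> \<notin> approx_point_spectrum T"
proof -
  let ?A = "shift_op T \<mu>"
  have A: "bounded_clinear ?A" by (rule bounded_clinear_shift_op[OF T])
  obtain p where p: "quasinilpotent_part ?A = null_space (?A ^^ p)"
    using H unfolding H_operator_def by blast
  have "x = 0" if "(?A ^^ n) x = 0" for n x
    using that N by (induction n) (auto simp: null_space_def)
  moreover have "(?A ^^ p) 0 = 0"
    using bounded_clinear_bounded_linear[OF bounded_clinear_funpow[OF A]]
    by (simp add: linear_0 bounded_linear.linear)
  ultimately have H0: "quasinilpotent_part ?A = {0}" unfolding p null_space_def by auto
  obtain e where e: "e > 0" "\<forall>\<nu>\<in>spectrum T. dist \<mu> \<nu> < e \<longrightarrow> \<nu> = \<mu>"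
    using iso by (auto simp: iso_def isolated_in_dist_Ex_iff)
  have "\<exists>G. bounded_clinear G \<and> G \<circ> shift_op ?A z = id \<and> shift_op ?A z \<circ> G = id"
    if "0 < cmod z" "cmod z < e" for z
  proof -
    have "\<mu> + z \<notin> spectrum T" using e(2) that by (force simp: dist_norm)
    then show ?thesis by (auto simp: spectrum_def shift_op_shift_op)
  qed
  then obtain G where G: "\<And>z. 0 < cmod z \<Longrightarrow> cmod z < e \<Longrightarrow>
      bounded_clinear (G z) \<and> G z \<circ> shift_op ?A z = id \<and> shift_op ?A z \<circ> G z = id"
    by metis
  interpret punctured_resolvent ?A G e
  proof
    fix z :: complex assume z: "0 < cmod z" "cmod z < e"
    show "bounded_clinear (G z)" using G[OF z] by blast
    fix x
    have eq: "?A y - scaleC z y = shift_op ?A z y" for y by (simp only: shift_op_def[of ?A])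
    have "(G z \<circ> shift_op ?A z) x = x" "(shift_op ?A z \<circ> G z) x = x"
      using G[OF z] by simp_all
    then show "G z (?A x - scaleC z x) = x" "?A (G z x) - scaleC z (G z x) = x"
      unfolding eq o_apply by blast+
  qed (rule A)
  show ?thesis
    using bounded_below_if_quasinilpotent_part_trivial[OF e(1) H0]
    unfolding not_approx_point_spectrum_iff[OF T] .
qed

section \<open>Direct sums\<close>

lemma shift_op_map_prod: "shift_op (map_prod S T) \<mu> = map_prod (shift_op S \<mu>) (shift_op T \<mu>)"
  by (auto simp: shift_op_def scaleC_prod_def)

lemma map_prod_funpow:
  fixes S :: "'a \<Rightarrow> 'a" and T :: "'b \<Rightarrow> 'b"
  shows "map_prod S T ^^ n = map_prod (S ^^ n) (T ^^ n)"
  by (induction n) (simp_all add: fun_eq_iff)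

lemma null_space_map_prod: "null_space (map_prod S T) = null_space S \<times> null_space T"
  by (auto simp: null_space_def zero_prod_def)

lemma finite_dimensional_image:
  assumes "Vector_Spaces.linear scaleC scaleC f" "finite_dimensional M"
  shows "finite_dimensional (f ` M)"
proof -
  interpret Vector_Spaces.linear scaleC scaleC f by fact
  obtain B where "finite B" "M \<subseteq> complex_vector.span B"
    using assms(2) by (auto simp: finite_dimensional_def)
  then show ?thesis
    unfolding finite_dimensional_def using span_image[of B] by (intro exI[of _ "f ` B"]) auto
qed

lemma linear_scaleCI:
  "(\<And>x y. f (x + y) = f x + f y) \<Longrightarrow> (\<And>c x. f (scaleC c x) = scaleC c (f x)) \<Longrightarrow>
    Vector_Spaces.linear scaleC scaleC f"
  unfolding Vector_Spaces.linear_iff by (intro conjI complex_vector.vector_space_axioms) auto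

lemma finite_dimensional_Times_iff:
  assumes "0 \<in> M" "0 \<in> N"
  shows "finite_dimensional (M \<times> N) \<longleftrightarrow> finite_dimensional M \<and> finite_dimensional N"
proof safe
  assume MN: "finite_dimensional (M \<times> N)"
  have "finite_dimensional (fst ` (M \<times> N))" "finite_dimensional (snd ` (M \<times> N))"
    by (intro finite_dimensional_image[OF _ MN] linear_scaleCI; simp add: scaleC_prod_def)+
  then show "finite_dimensional M" "finite_dimensional N"
    using assms by (auto simp: fst_image_times snd_image_times split: if_splits)
next
  assume M: "finite_dimensional M" and N: "finite_dimensional N"
  have "finite_dimensional ((\<lambda>x. (x, 0 :: 'b)) ` M)"
    by (intro finite_dimensional_image[OF _ M] linear_scaleCI) (auto simp: scaleC_prod_def)
  then obtain B where B: "finite B" "(\<lambda>x. (x, 0 :: 'b)) ` M \<subseteq> complex_vector.span B"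
    by (auto simp: finite_dimensional_def)
  have "finite_dimensional ((\<lambda>y. (0 :: 'a, y)) ` N)"
    by (intro finite_dimensional_image[OF _ N] linear_scaleCI) (auto simp: scaleC_prod_def)
  then obtain C where C: "finite C" "(\<lambda>y. (0 :: 'a, y)) ` N \<subseteq> complex_vector.span C"
    by (auto simp: finite_dimensional_def)
  have "(x, y) \<in> complex_vector.span (B \<union> C)" if "x \<in> M" "y \<in> N" for x y
  proof -
    have "(x, 0) \<in> complex_vector.span (B \<union> C)" "(0, y) \<in> complex_vector.span (B \<union> C)"
      using B(2) C(2) that complex_vector.span_mono[of B "B \<union> C"]
        complex_vector.span_mono[of C "B \<union> C"] by blast+
    from complex_vector.span_add[OF this] show ?thesis by simp
  qed
  then show "finite_dimensional (M \<times> N)"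
    unfolding finite_dimensional_def using B(1) C(1) by (intro exI[of _ "B \<union> C"]) auto
qed

lemma closed_Times_iff:
  fixes A :: "'a::real_normed_vector set" and B :: "'b::real_normed_vector set"
  assumes "0 \<in> A" "0 \<in> B"
  shows "closed (A \<times> B) \<longleftrightarrow> closed A \<and> closed B"
proof safe
  assume AB: "closed (A \<times> B)"
  have "closed ((\<lambda>x. (x, 0)) -` (A \<times> B))" "closed ((\<lambda>y. (0, y)) -` (A \<times> B))"
    by (intro closed_vimage[OF AB] continuous_intros)+
  moreover have "(\<lambda>x. (x, 0)) -` (A \<times> B) = A" "(\<lambda>y. (0, y)) -` (A \<times> B) = B"
    using assms by auto
  ultimately show "closed A" "closed B" by simp_all
qed (rule closed_Times)

lemma upper_semi_Fredholm_map_prod_iff: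
  assumes S: "bounded_clinear S" and T: "bounded_clinear T"
  shows "upper_semi_Fredholm (map_prod S T) \<longleftrightarrow> upper_semi_Fredholm S \<and> upper_semi_Fredholm T"
proof -
  have 0: "S 0 = 0" "T 0 = 0"
    using S T by (simp_all add: linear_0 bounded_linear.linear bounded_clinear_bounded_linear)
  then have r0: "0 \<in> range S" "0 \<in> range T" by (metis rangeI)+
  have n0: "0 \<in> null_space S" "0 \<in> null_space T" using 0 by (simp_all add: null_space_def)
  have range: "range (map_prod S T) = range S \<times> range T" by force
  show ?thesis
    unfolding upper_semi_Fredholm_iff null_space_map_prod range
      closed_Times_iff[OF r0] finite_dimensional_Times_iff[OF n0] by blast
qed

lemma bounded_clinear_embed_project:
  assumes R: "bounded_clinear (R :: 'a::complex_banach \<times> 'b::complex_banach \<Rightarrow> 'a \<times> 'b)"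
  shows "bounded_clinear (\<lambda>x. fst (R (x, 0)))" "bounded_clinear (\<lambda>y. snd (R (0, y)))"
proof -
  have R': "bounded_linear R" using R by (rule bounded_clinear_bounded_linear)
  have "bounded_linear (\<lambda>x. (x, 0 :: 'b))" "bounded_linear (\<lambda>y. (0 :: 'a, y))"
    by (intro bounded_linear_Pair bounded_linear_ident bounded_linear_zero)+
  note * = this[THEN bounded_linear_compose[OF R']]
  have "R (scaleC c x, 0) = scaleC c (R (x, 0))" for c x
    using bounded_clinear_scaleC[OF R, of c "(x, 0)"] by (simp add: scaleC_prod_def)
  moreover have "R (0, scaleC c y) = scaleC c (R (0, y))" for c y
    using bounded_clinear_scaleC[OF R, of c "(0, y)"] by (simp add: scaleC_prod_def)
  ultimately show "bounded_clinear (\<lambda>x. fst (R (x, 0)))" "bounded_clinear (\<lambda>y. snd (R (0, y)))"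
    unfolding bounded_clinear_def
    using bounded_linear_compose[OF bounded_linear_fst *(1)]
      bounded_linear_compose[OF bounded_linear_snd *(2)]
    by (simp_all add: scaleC_prod_def)
qed

lemma spectrum_map_prod:
  assumes S: "bounded_clinear S" and T: "bounded_clinear T"
  shows "spectrum (map_prod S T) = spectrum S \<union> spectrum T"
proof -
  have "\<mu> \<notin> spectrum (map_prod S T) \<longleftrightarrow> \<mu> \<notin> spectrum S \<and> \<mu> \<notin> spectrum T" for \<mu>
  proof -
    let ?A = "shift_op S \<mu>" and ?B = "shift_op T \<mu>"
    have 0: "?A 0 = 0" "?B 0 = 0"
      using S T by (simp_all add: linear_0 bounded_linear.linear bounded_clinear_bounded_linear
          bounded_clinear_shift_op)
    show ?thesis
    proof
      assume "\<mu> \<notin> spectrum (map_prod S T)"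
      then obtain R where R: "bounded_clinear R" "R \<circ> map_prod ?A ?B = id" "map_prod ?A ?B \<circ> R = id"
        by (auto simp: spectrum_def shift_op_map_prod)
      have l: "R (?A x, ?B y) = (x, y)" for x y using fun_cong[OF R(2), of "(x, y)"] by simp
      have r: "?A (fst (R z)) = fst z" "?B (snd (R z)) = snd z" for z
        using fun_cong[OF R(3), of z] by (auto simp: map_prod_def split_beta dest: arg_cong[of _ _ fst] arg_cong[of _ _ snd])
      \<comment> \<open>the diagonal blocks of an inverse of a diagonal operator invert its entries\<close>
      have "(\<lambda>x. fst (R (x, 0))) \<circ> ?A = id" "?A \<circ> (\<lambda>x. fst (R (x, 0))) = id"
        using l[of _ 0] r(1) 0 by auto
      moreover have "(\<lambda>y. snd (R (0, y))) \<circ> ?B = id" "?B \<circ> (\<lambda>y. snd (R (0, y))) = id"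
        using l[of 0] r(2) 0 by auto
      ultimately show "\<mu> \<notin> spectrum S \<and> \<mu> \<notin> spectrum T"
        using bounded_clinear_embed_project[OF R(1)] unfolding spectrum_def by blast
    next
      assume "\<mu> \<notin> spectrum S \<and> \<mu> \<notin> spectrum T"
      then obtain R1 R2 where R: "bounded_clinear R1" "R1 \<circ> ?A = id" "?A \<circ> R1 = id"
        "bounded_clinear R2" "R2 \<circ> ?B = id" "?B \<circ> R2 = id"
        by (auto simp: spectrum_def)
      then have "map_prod R1 R2 \<circ> map_prod ?A ?B = id" "map_prod ?A ?B \<circ> map_prod R1 R2 = id"
        by (simp_all add: map_prod_compose[symmetric] map_prod.id)
      then show "\<mu> \<notin> spectrum (map_prod S T)"
        using bounded_clinear_map_prod[OF R(1,4)]
        unfolding spectrum_def shift_op_map_prod by blast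
    qed
  qed
  then show ?thesis by blast
qed

lemma approx_point_spectrum_map_prod:
  assumes S: "bounded_clinear S" and T: "bounded_clinear T"
  shows "approx_point_spectrum (map_prod S T) = approx_point_spectrum S \<union> approx_point_spectrum T"
proof -
  have "\<mu> \<notin> approx_point_spectrum (map_prod S T) \<longleftrightarrow>
      \<mu> \<notin> approx_point_spectrum S \<and> \<mu> \<notin> approx_point_spectrum T" for \<mu>
  proof -
    let ?A = "shift_op S \<mu>" and ?B = "shift_op T \<mu>"
    have 0: "?A 0 = 0" "?B 0 = 0"
      using S T by (simp_all add: linear_0 bounded_linear.linear bounded_clinear_bounded_linear
          bounded_clinear_shift_op)
    have "(\<exists>c>0. \<forall>z. c * norm z \<le> norm (map_prod ?A ?B z)) \<longleftrightarrow>
        (\<exists>c>0. \<forall>x. c * norm x \<le> norm (?A x)) \<and> (\<exists>c>0. \<forall>y. c * norm y \<le> norm (?B y))"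
      (is "?L \<longleftrightarrow> ?R1 \<and> ?R2")
    proof
      assume ?L
      then obtain c where c: "c > 0" "\<And>z. c * norm z \<le> norm (map_prod ?A ?B z)" by blast
      have "c * norm x \<le> norm (?A x)" "c * norm y \<le> norm (?B y)" for x y
        using c(2)[of "(x, 0)"] c(2)[of "(0, y)"] 0 by (simp_all add: norm_Pair)
      with c(1) show "?R1 \<and> ?R2" by blast
    next
      assume "?R1 \<and> ?R2"
      then obtain a b where a: "a > 0" "\<And>x. a * norm x \<le> norm (?A x)"
        and b: "b > 0" "\<And>y. b * norm y \<le> norm (?B y)" by blast
      define c where "c = min a b"
      have c: "c > 0" using a(1) b(1) by (simp add: c_def)
      have A: "c * norm x \<le> norm (?A x)" for x
        using a(2)[of x] mult_right_mono[of c a "norm x"] by (simp add: c_def)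
      have B: "c * norm y \<le> norm (?B y)" for y
        using b(2)[of y] mult_right_mono[of c b "norm y"] by (simp add: c_def)
      have "c * norm z \<le> norm (map_prod ?A ?B z)" for z
      proof -
        have "c * norm z = sqrt ((c * norm (fst z))\<^sup>2 + (c * norm (snd z))\<^sup>2)"
          using c by (simp add: norm_prod_def power_mult_distrib real_sqrt_mult flip: distrib_left)
        also have "\<dots> \<le> sqrt ((norm (?A (fst z)))\<^sup>2 + (norm (?B (snd z)))\<^sup>2)"
          using A B c by (intro real_sqrt_le_mono add_mono power_mono) auto
        also have "\<dots> = norm (map_prod ?A ?B z)" by (simp add: norm_prod_def)
        finally show ?thesis .
      qed
      with c show ?L by blast
    qed
    then show ?thesis
      unfolding not_approx_point_spectrum_iff[OF S] not_approx_point_spectrum_iff[OF T]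
        not_approx_point_spectrum_iff[OF bounded_clinear_map_prod[OF S T]] shift_op_map_prod .
  qed
  then show ?thesis by blast
qed

text \<open>
The norm of a pair lies between the maximum of the two norms and twice that maximum, and the factor
\<open>2\<close> disappears because \<open>root n 2\<close> tends to \<open>1\<close>.
\<close>

lemma quasinilpotent_part_map_prod:
  "quasinilpotent_part (map_prod S T) = quasinilpotent_part S \<times> quasinilpotent_part T"
proof -
  have "(x, y) \<in> quasinilpotent_part (map_prod S T) \<longleftrightarrow>
      x \<in> quasinilpotent_part S \<and> y \<in> quasinilpotent_part T" for x y
  proof -
    define a where "a n = norm ((S ^^ n) x)" for n
    define b where "b n = norm ((T ^^ n) y)" for n
    define c where "c n = norm ((S ^^ n) x, (T ^^ n) y)" for n
    have ac: "a n \<le> c n" and bc: "b n \<le> c n" for n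
      unfolding a_def b_def c_def by (metis fst_conv norm_fst_le, metis snd_conv norm_snd_le)
    have cab: "c n \<le> 2 * max (a n) (b n)" for n
      using norm_Pair_le[of "(S ^^ n) x" "(T ^^ n) y"] unfolding a_def b_def c_def by linarith
    have a0: "0 \<le> a n" and b0: "0 \<le> b n" for n by (simp_all add: a_def b_def)
    have "(\<lambda>n. root n (c n)) \<longlonglongrightarrow> 0 \<longleftrightarrow> (\<lambda>n. root n (a n)) \<longlonglongrightarrow> 0 \<and> (\<lambda>n. root n (b n)) \<longlonglongrightarrow> 0"
    proof safe
      assume c: "(\<lambda>n. root n (c n)) \<longlonglongrightarrow> 0"
      have "norm (root n (a n)) \<le> root n (c n)" "norm (root n (b n)) \<le> root n (c n)" for n
        using ac bc a0 b0 by (cases "n = 0"; simp add: real_root_ge_zero)+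
      then show "(\<lambda>n. root n (a n)) \<longlonglongrightarrow> 0" "(\<lambda>n. root n (b n)) \<longlonglongrightarrow> 0"
        by (intro Lim_null_comparison[OF _ c] always_eventually allI; simp)+
    next
      assume ab: "(\<lambda>n. root n (a n)) \<longlonglongrightarrow> 0" "(\<lambda>n. root n (b n)) \<longlonglongrightarrow> 0"
      have "norm (root n (c n)) \<le> root n 2 * (root n (a n) + root n (b n))" for n
      proof (cases "n = 0")
        case False
        then have "root n (c n) \<le> root n (2 * max (a n) (b n))" using cab by simp
        also have "\<dots> = root n 2 * root n (max (a n) (b n))" by (rule real_root_mult)
        also have "\<dots> \<le> root n 2 * (root n (a n) + root n (b n))"
          using a0 b0 by (intro mult_left_mono) (auto simp: max_def real_root_ge_zero)
        finally show ?thesis by (simp add: real_root_ge_zero c_def)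
      qed simp
      moreover have "(\<lambda>n. root n 2 * (root n (a n) + root n (b n))) \<longlonglongrightarrow> 1 * (0 + 0)"
        by (intro tendsto_intros ab LIMSEQ_root_const) simp
      then have "(\<lambda>n. root n 2 * (root n (a n) + root n (b n))) \<longlonglongrightarrow> 0" by simp
      ultimately show "(\<lambda>n. root n (c n)) \<longlonglongrightarrow> 0"
        by (intro Lim_null_comparison[of "\<lambda>n. root n (c n)"] always_eventually allI)
    qed
    then show ?thesis
      by (simp add: quasinilpotent_part_def map_prod_funpow a_def b_def c_def)
  qed
  then show ?thesis by auto
qed

lemma H_operator_map_prod:
  assumes S: "bounded_clinear S" and T: "bounded_clinear T"
    and HS: "H_operator S" and HT: "H_operator T"
  shows "H_operator (map_prod S T)"
  unfolding H_operator_def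
proof
  fix \<mu>
  let ?A = "shift_op S \<mu>" and ?B = "shift_op T \<mu>"
  have A: "bounded_clinear ?A" and B: "bounded_clinear ?B"
    by (rule bounded_clinear_shift_op[OF S], rule bounded_clinear_shift_op[OF T])
  obtain p where p: "quasinilpotent_part ?A = null_space (?A ^^ p)"
    using HS unfolding H_operator_def by blast
  obtain q where q: "quasinilpotent_part ?B = null_space (?B ^^ q)"
    using HT unfolding H_operator_def by blast
  have "null_space (?A ^^ max p q) = null_space (?A ^^ p)"
    using null_space_funpow_mono[OF A, of p "max p q"]
      null_space_funpow_subset_quasinilpotent_part[OF A, of "max p q"] p by auto
  moreover have "null_space (?B ^^ max p q) = null_space (?B ^^ q)"
    using null_space_funpow_mono[OF B, of q "max p q"]
      null_space_funpow_subset_quasinilpotent_part[OF B, of "max p q"] q by auto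
  ultimately show "\<exists>p. quasinilpotent_part (shift_op (map_prod S T) \<mu>) =
      null_space (shift_op (map_prod S T) \<mu> ^^ p)"
    unfolding shift_op_map_prod quasinilpotent_part_map_prod map_prod_funpow null_space_map_prod p q
    by (intro exI[of _ "max p q"]) simp
qed

text \<open>
Closedness is needed for a point that lies in only one of the sets: the other set then avoids a
neighbourhood of it.
\<close>

lemma iso_Un_iff:
  assumes "closed A" "closed B"
  shows "\<mu> \<in> iso (A \<union> B) \<longleftrightarrow>
    \<mu> \<in> A \<union> B \<and> (\<mu> \<in> A \<longrightarrow> \<mu> \<in> iso A) \<and> (\<mu> \<in> B \<longrightarrow> \<mu> \<in> iso B)"
  using assms unfolding iso_def closed_limpt
  by (auto simp: isolated_in_islimpt_iff islimpt_Un)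

lemma property_z_null_space_nontrivial:
  assumes T: "bounded_clinear T" and H: "H_operator T" and z: "property_z T"
    and iso: "\<mu> \<in> iso (approx_point_spectrum T)"
  shows "null_space (shift_op T \<mu>) \<noteq> {0}"
proof
  assume "null_space (shift_op T \<mu>) = {0}"
  then have "\<mu> \<notin> approx_point_spectrum T"
    using H_operator_isoloid[OF T H] iso property_z_imp_spectrum_eq[OF T H z] by simp
  then show False using iso by (auto simp: iso_def isolated_in_def)
qed

text \<open>
The nullity of a direct sum may be positive with one summand injective, so property \<open>(z)\<close> as defined
does not split into conditions on the summands. At isolated points of \<open>\<sigma>\<^sub>a\<close> positivity is automatic, and
the remaining conditions do split.
\<close>

lemma property_z_upper_semi_Fredholm_iff:
  assumes T: "bounded_clinear T" and H: "H_operator T" and z: "property_z T"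
  shows "upper_semi_Fredholm (shift_op T \<mu>) \<longleftrightarrow>
    (\<mu> \<in> approx_point_spectrum T \<longrightarrow> \<mu> \<in> iso (approx_point_spectrum T)) \<and>
    finite_dimensional (null_space (shift_op T \<mu>))"
proof (cases "\<mu> \<in> approx_point_spectrum T")
  case False
  then have "upper_semi_Fredholm (shift_op T \<mu>)"
    using H_operator_upper_semi_Weyl_if_not_approx[OF T H] H_operator_upper_semi_Weyl_iff[OF T H]
    by (simp add: upper_semi_Weyl_spectrum_def)
  with False show ?thesis by (simp add: upper_semi_Fredholm_iff)
next
  case True
  then have mu: "\<mu> \<in> spectrum T" using property_z_imp_spectrum_eq[OF T H z] by simp
  have "upper_semi_Fredholm (shift_op T \<mu>) \<longleftrightarrow> \<mu> \<in> isolated_finite_mult_eigenvalues T"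
    using z mu H_operator_upper_semi_Weyl_iff[OF T H]
    unfolding property_z_def upper_semi_Weyl_spectrum_def by blast
  also have "\<dots> \<longleftrightarrow> \<mu> \<in> iso (approx_point_spectrum T) \<and>
      nullity (shift_op T \<mu>) \<noteq> 0 \<and> finite_dimensional (null_space (shift_op T \<mu>))"
    unfolding isolated_finite_mult_eigenvalues_def finite_mult_eigenvalues_def
      nullity_less_infinity_iff by (simp add: zero_less_iff_neq_zero)
  finally show ?thesis
    using True property_z_null_space_nontrivial[OF T H z]
      nullity_eq_0_iff[OF bounded_clinear_shift_op[OF T]] by blast
qed

lemma property_z_map_prod:
  assumes S: "bounded_clinear S" and T: "bounded_clinear T"
    and HS: "H_operator S" and HT: "H_operator T"
    and zS: "property_z S" and zT: "property_z T"
  shows "property_z (map_prod S T)"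
proof -
  have P: "bounded_clinear (map_prod S T)" by (rule bounded_clinear_map_prod[OF S T])
  have HP: "H_operator (map_prod S T)" by (rule H_operator_map_prod[OF S T HS HT])
  have "\<mu> \<in> spectrum (map_prod S T) - upper_semi_Weyl_spectrum (map_prod S T) \<longleftrightarrow>
      \<mu> \<in> isolated_finite_mult_eigenvalues (map_prod S T)" for \<mu>
  proof -
    let ?A = "shift_op S \<mu>" and ?B = "shift_op T \<mu>"
    let ?aS = "approx_point_spectrum S" and ?aT = "approx_point_spectrum T"
    have A: "bounded_clinear ?A" and B: "bounded_clinear ?B"
      by (rule bounded_clinear_shift_op[OF S], rule bounded_clinear_shift_op[OF T])
    have 0: "0 \<in> null_space ?A" "0 \<in> null_space ?B"
      using complex_vector.subspace_0 subspace_null_space A B by blast+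
    have iso: "\<mu> \<in> iso (?aS \<union> ?aT) \<longleftrightarrow>
        \<mu> \<in> ?aS \<union> ?aT \<and> (\<mu> \<in> ?aS \<longrightarrow> \<mu> \<in> iso ?aS) \<and> (\<mu> \<in> ?aT \<longrightarrow> \<mu> \<in> iso ?aT)"
      by (rule iso_Un_iff[OF closed_approx_point_spectrum[OF S] closed_approx_point_spectrum[OF T]])
    have "\<mu> \<in> spectrum (map_prod S T) - upper_semi_Weyl_spectrum (map_prod S T) \<longleftrightarrow>
        \<mu> \<in> ?aS \<union> ?aT \<and> upper_semi_Fredholm ?A \<and> upper_semi_Fredholm ?B"
      unfolding upper_semi_Weyl_spectrum_def Diff_iff mem_Collect_eq not_not
        H_operator_upper_semi_Weyl_iff[OF P HP]
      unfolding shift_op_map_prod upper_semi_Fredholm_map_prod_iff[OF A B] spectrum_map_prod[OF S T]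
        property_z_imp_spectrum_eq[OF S HS zS] property_z_imp_spectrum_eq[OF T HT zT] ..
    also have "\<dots> \<longleftrightarrow> \<mu> \<in> iso (?aS \<union> ?aT) \<and>
        finite_dimensional (null_space ?A) \<and> finite_dimensional (null_space ?B)"
      unfolding iso property_z_upper_semi_Fredholm_iff[OF S HS zS]
        property_z_upper_semi_Fredholm_iff[OF T HT zT] by blast
    also have "\<dots> \<longleftrightarrow> \<mu> \<in> iso (?aS \<union> ?aT) \<and> null_space (map_prod ?A ?B) \<noteq> {0} \<and>
        finite_dimensional (null_space (map_prod ?A ?B))"
    proof -
      have N: "null_space (map_prod ?A ?B) \<noteq> {0}" if "\<mu> \<in> iso (?aS \<union> ?aT)"
      proof -
        from that consider "\<mu> \<in> iso ?aS" | "\<mu> \<in> iso ?aT" unfolding iso by blast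
        then have "null_space ?A \<noteq> {0} \<or> null_space ?B \<noteq> {0}"
          using property_z_null_space_nontrivial[OF S HS zS, of \<mu>]
            property_z_null_space_nontrivial[OF T HT zT, of \<mu>] by cases simp_all
        then obtain x y where "x \<in> null_space ?A" "y \<in> null_space ?B" "x \<noteq> 0 \<or> y \<noteq> 0"
          using 0 by blast
        then have "(x, y) \<in> null_space (map_prod ?A ?B)" "(x, y) \<noteq> 0"
          by (simp_all add: null_space_map_prod zero_prod_def)
        then show ?thesis by blast
      qed
      have "finite_dimensional (null_space (map_prod ?A ?B)) \<longleftrightarrow>
          finite_dimensional (null_space ?A) \<and> finite_dimensional (null_space ?B)"
        unfolding null_space_map_prod by (rule finite_dimensional_Times_iff[OF 0])
      then show ?thesis using N by argo
    qed
    also have "\<dots> \<longleftrightarrow> \<mu> \<in> isolated_finite_mult_eigenvalues (map_prod S T)"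
      unfolding isolated_finite_mult_eigenvalues_def finite_mult_eigenvalues_def
        nullity_less_infinity_iff approx_point_spectrum_map_prod[OF S T] shift_op_map_prod
      by (simp add: zero_less_iff_neq_zero nullity_eq_0_iff[OF bounded_clinear_map_prod[OF A B]])
    finally show ?thesis .
  qed
  then show ?thesis unfolding property_z_def by blast
qed

theorem proposition4p2:
  fixes S :: "'a::complex_banach \<Rightarrow> 'a" and T :: "'b::complex_banach \<Rightarrow> 'b"
  assumes "cdim (UNIV :: 'a set) = \<infinity>" and "cdim (UNIV :: 'b set) = \<infinity>"
    and "bounded_clinear S" and "bounded_clinear T"
    and "H_operator S" and "H_operator T"
  shows "(property_az S \<and> property_az T \<longrightarrow> property_az (map_prod S T)) \<and>
         (property_z S \<and> property_z T \<longrightarrow> property_z (map_prod S T))"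
proof (intro conjI impI; elim conjE)
  note S = \<open>bounded_clinear S\<close> and T = \<open>bounded_clinear T\<close>
    and HS = \<open>H_operator S\<close> and HT = \<open>H_operator T\<close>
  assume "property_az S" "property_az T"
  then show "property_az (map_prod S T)"
    unfolding property_az_iff[OF S HS] property_az_iff[OF T HT]
      property_az_iff[OF bounded_clinear_map_prod[OF S T] H_operator_map_prod[OF S T HS HT]]
    by (simp add: spectrum_map_prod[OF S T] approx_point_spectrum_map_prod[OF S T])
next
  assume "property_z S" "property_z T"
  with assms(3-6) show "property_z (map_prod S T)" by (rule property_z_map_prod)
qed

end
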